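(* Let $\mathbf{x}:(U,0)\to(\mathbb{R}^3,0)$ be a wavefront parallelly smoothable at $0\in\Sigma(\mathbf{x})$ with $\mathrm{rank}(D\mathbf{x}(0))=0$. Then, up to an isometry of $\mathbb{R}^3$, $\mathbf{x}$ is $\mathscr{R}$-equivalent to $$\mathbf{y}(u,v)=\Big(h_u,\ h_v,\ \int_0^u\big(t_1h_{uu}(t_1,v)+v\,h_{vu}(t_1,v)\big)\,dt_1+\int_0^v t_2h_{vv}(0,t_2)\,dt_2\Big),$$ in which $h$ is a smooth concave or convex function on a convex neighborhood of $0$ with $h_{uu}(0)=h_{uv}(0)=h_{vv}(0)=0$.
   Context: All maps are $C^\infty$ and $U\subset\mathbb{R}^2$ is open. $D$ denotes the Jacobian matrix. A map $\mathbf{x}:U\to\mathbb{R}^3$ is a frontal if near each point $p$ there is a smooth unit vector field $\mathbf{n}_p$ orthogonal to $\mathbf{x}_u,\mathbf{x}_v$, and a wavefront if moreover each $(\mathbf{x},\mathbf{n}_p)$ is an immersion into $\mathbb{R}^3\times S^2$; a smooth unit normal field $\mathbf{n}$ on $U$ is assumed to be fixed. $\Sigma(\mathbf{x})$ is the set of points where $\mathbf{x}$ is not immersive. A wavefront $\mathbf{x}$ is parallelly smoothable at $p\in\Sigma(\mathbf{x})$ if there exist $\epsilon>0$ and an open neighborhood $V$ of $p$ such that $\mathrm{rank}(D(\mathbf{x}+l\mathbf{n})(q))=2$ for every $(q,l)\in V\times(0,\epsilon)$ or for every $(q,l)\in V\times(-\epsilon,0)$. Two map germs $\mathbf{f}_1:(U_1,p)\to(\mathbb{R}^n,q)$,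 $\mathbf{f}_2:(U_2,p)\to(\mathbb{R}^n,q)$ are $\mathscr{R}$-equivalent if $\mathbf{f}_2=\mathbf{f}_1\circ\mathbf{h}$ for a diffeomorphism germ $\mathbf{h}:(U_2,p)\to(U_1,p)$. "Up to an isometry" means after composing $\mathbf{x}$ on the left with an isometry of $\mathbb{R}^3$. *)

theory Defs
  imports "HOL-Analysis.Analysis"
begin

(* Only used for open S, so that the derivative at a point does not depend on
   the values of f outside S. *)
fun Ck_on :: "nat \<Rightarrow> 'a::real_normed_vector set \<Rightarrow> ('a \<Rightarrow> 'b::real_normed_vector) \<Rightarrow> bool" where
  "Ck_on 0 S f \<longleftrightarrow> continuous_on S f"
| "Ck_on (Suc k) S f \<longleftrightarrow>
     (\<forall>p\<in>S. f differentiable (at p)) \<and>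
     (\<forall>w. Ck_on k S (\<lambda>p. frechet_derivative f (at p) w))"

definition smooth_on :: "'a::real_normed_vector set \<Rightarrow> ('a \<Rightarrow> 'b::real_normed_vector) \<Rightarrow> bool" where
  "smooth_on S f \<longleftrightarrow> (\<forall>k. Ck_on k S f)"

text \<open>The coordinates on \<open>real^2\<close> are \<open>u\<close> (index 1) and \<open>v\<close> (index 2).  Iterated subscripts are
  read left to right: \<open>f\<^sub>v\<^sub>u\<close> is \<open>partial 1 (partial 2 f)\<close>.\<close>

definition partial :: "2 \<Rightarrow> (real^2 \<Rightarrow> 'b::real_normed_vector) \<Rightarrow> real^2 \<Rightarrow> 'b" where
  "partial i f p = frechet_derivative f (at p) (axis i 1)"

definition immersive_at :: "('a::real_normed_vector \<Rightarrow> 'b::real_normed_vector) \<Rightarrow> 'a \<Rightarrow> bool" where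
  "immersive_at f p \<longleftrightarrow> f differentiable (at p) \<and> inj (frechet_derivative f (at p))"

definition unit_normal_on :: "(real^2) set \<Rightarrow> (real^2 \<Rightarrow> real^3) \<Rightarrow> (real^2 \<Rightarrow> real^3) \<Rightarrow> bool" where
  "unit_normal_on W x n \<longleftrightarrow>
     smooth_on W n \<and>
     (\<forall>q\<in>W. norm (n q) = 1 \<and> n q \<bullet> partial 1 x q = 0 \<and> n q \<bullet> partial 2 x q = 0)"

definition frontal :: "(real^2) set \<Rightarrow> (real^2 \<Rightarrow> real^3) \<Rightarrow> bool" where
  "frontal U x \<longleftrightarrow>
     smooth_on U x \<and>
     (\<forall>p\<in>U. \<exists>W n. open W \<and> p \<in> W \<and> W \<subseteq> U \<and> unit_normal_on W x n)"

text \<open>The target \<open>\<real>\<^sup>3 \<times> S\<^sup>2\<close> is regarded as a submanifold of \<open>\<real>\<^sup>3 \<times> \<real>\<^sup>3\<close>; being an immersion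
  does not depend on which of the two is taken as the codomain.\<close>

definition wavefront :: "(real^2) set \<Rightarrow> (real^2 \<Rightarrow> real^3) \<Rightarrow> bool" where
  "wavefront U x \<longleftrightarrow>
     frontal U x \<and>
     (\<forall>p\<in>U. \<exists>W n. open W \<and> p \<in> W \<and> W \<subseteq> U \<and> unit_normal_on W x n \<and>
        (\<forall>q\<in>W. immersive_at (\<lambda>r. (x r, n r)) q))"

definition singular_set :: "(real^2) set \<Rightarrow> (real^2 \<Rightarrow> real^3) \<Rightarrow> (real^2) set" where
  "singular_set U x = {p\<in>U. \<not> immersive_at x p}"

definition parallelly_smoothable_at ::
  "(real^2) set \<Rightarrow> (real^2 \<Rightarrow> real^3) \<Rightarrow> (real^2 \<Rightarrow> real^3) \<Rightarrow> real^2 \<Rightarrow> bool" where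
  "parallelly_smoothable_at U x n p \<longleftrightarrow>
     p \<in> singular_set U x \<and>
     (\<exists>\<epsilon>>0. \<exists>V. open V \<and> p \<in> V \<and> V \<subseteq> U \<and>
        ((\<forall>q\<in>V. \<forall>l\<in>{0<..<\<epsilon>}. rank (jacobian (\<lambda>r. x r + l *\<^sub>R n r) (at q)) = 2) \<or>
         (\<forall>q\<in>V. \<forall>l\<in>{-\<epsilon><..<0}. rank (jacobian (\<lambda>r. x r + l *\<^sub>R n r) (at q)) = 2)))"

definition diffeo_germ :: "('a::real_normed_vector \<Rightarrow> 'b::real_normed_vector) \<Rightarrow> 'a \<Rightarrow> 'b \<Rightarrow> bool" where
  "diffeo_germ \<phi> p q \<longleftrightarrow>
     \<phi> p = q \<and>
     (\<exists>S T \<psi>. open S \<and> p \<in> S \<and> open T \<and> homeomorphism S T \<phi> \<psi> \<and> smooth_on S \<phi> \<and> smooth_on T \<psi>)"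

text \<open>A germ at \<open>p\<close> is represented by any total function agreeing with it near \<open>p\<close>.\<close>

definition R_equivalent_at ::
  "'a::real_normed_vector \<Rightarrow> ('a \<Rightarrow> 'b::real_normed_vector) \<Rightarrow> ('a \<Rightarrow> 'b) \<Rightarrow> bool" where
  "R_equivalent_at p f1 f2 \<longleftrightarrow>
     (\<exists>\<phi>. diffeo_germ \<phi> p p \<and> (\<forall>\<^sub>F w in nhds p. f2 w = f1 (\<phi> w)))"

definition euclidean_isometry :: "('a::metric_space \<Rightarrow> 'a) \<Rightarrow> bool" where
  "euclidean_isometry A \<longleftrightarrow> bij A \<and> (\<forall>a b. dist (A a) (A b) = dist a b)"

text \<open>The integrals are oriented, i.e. change sign when the upper limit is negative.\<close>

definition normal_form :: "(real^2 \<Rightarrow> real) \<Rightarrow> real^2 \<Rightarrow> real^3" where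
  "normal_form h p =
     (let u = p $ 1; v = p $ 2 in
      vector
       [partial 1 h p,
        partial 2 h p,
        (LBINT t1=ereal 0..ereal u.
           t1 * partial 1 (partial 1 h) (vector [t1, v])
           + v * partial 1 (partial 2 h) (vector [t1, v]))
        + (LBINT t2=ereal 0..ereal v. t2 * partial 2 (partial 2 h) (vector [0, t2]))])"

end

theory Submission
  imports Defs
begin

text \<open>
  Since \<open>Dx(0) = 0\<close>, the map \<open>x + l n\<close> can only be immersive at \<open>0\<close> if \<open>n\<close> is, so parallel
  smoothability forces \<open>n\<close> to be an immersion into the sphere near \<open>0\<close>.  After a rotation taking
  \<open>n(0)\<close> to the third basis vector, \<open>n\<close> is a positive multiple of \<open>(-u, -v, 1)\<close> for two smooth
  functions \<open>u, v\<close> on the source, and these form a chart at \<open>0\<close> by the inverse function theorem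
  (\<open>slope_coordinates\<close>).  Written in this chart, the surface \<open>X\<close> is orthogonal to \<open>n\<close> exactly when
  \<open>dX\<^sub>3 = u dX\<^sub>1 + v dX\<^sub>2\<close>.  This says that \<open>h = u X\<^sub>1 + v X\<^sub>2 - X\<^sub>3\<close>, a Legendre transform, has
  gradient \<open>(X\<^sub>1, X\<^sub>2)\<close>; integrating \<open>dX\<^sub>3\<close> first along the \<open>v\<close>-axis and then along a horizontal
  segment recovers \<open>X\<^sub>3\<close> from \<open>h\<close> in the shape required by the normal form.  The Hessian of \<open>h\<close> is
  the derivative of \<open>(X\<^sub>1, X\<^sub>2)\<close> and vanishes at \<open>0\<close> along with \<open>Dx(0)\<close>.

  For the sign of the Hessian, project to the first two coordinates, which loses nothing on vectors
  orthogonal to \<open>n\<close>.  There \<open>D(X + l n)\<close> becomes \<open>H - l S\<close>, with \<open>H\<close> the Hessian of \<open>h\<close> and \<open>S\<close>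
  the Hessian of \<open>\<surd>(1 + u\<^sup>2 + v\<^sup>2)\<close>, which is symmetric and positive definite.  If the form of \<open>H\<close>
  were positive somewhere, the maximum of its quotient by the form of \<open>S\<close> would be some \<open>l > 0\<close> with
  \<open>H - l S\<close> singular, and \<open>l\<close> is as small as \<open>H\<close> is; so near \<open>0\<close> this contradicts the
  immersivity of \<open>X + l n\<close> for small positive \<open>l\<close>.  Hence \<open>H \<le> 0\<close> and \<open>h\<close> is concave; if instead
  the parallel surfaces with small negative \<open>l\<close> are immersed, the same argument for \<open>-H\<close> makes \<open>h\<close>
  convex.
\<close>

section \<open>Calculus of smooth maps\<close>

lemma Ck_on_SucD:
  assumes "Ck_on (Suc k) S f" "p \<in> S"
  shows "(f has_derivative frechet_derivative f (at p)) (at p)"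
    and "Ck_on k S (\<lambda>p. frechet_derivative f (at p) w)"
  using assms by (auto simp: frechet_derivative_works)

lemma Ck_on_cong:
  assumes "open S" "Ck_on k S f" "\<And>p. p \<in> S \<Longrightarrow> f p = g p"
  shows "Ck_on k S g"
  using assms(2,3)
proof (induction k arbitrary: f g)
  case 0
  then show ?case by (metis Ck_on.simps(1) continuous_on_cong)
next
  case (Suc k)
  have d: "(g has_derivative frechet_derivative f (at p)) (at p)" if "p \<in> S" for p
    using has_derivative_transform_within_open[OF Ck_on_SucD(1)[OF Suc.prems(1) that] \<open>open S\<close> that]
      Suc.prems(2) by blast
  have "Ck_on k S (\<lambda>p. frechet_derivative g (at p) w)" for w
  proof (rule Suc.IH)
    show "Ck_on k S (\<lambda>p. frechet_derivative f (at p) w)"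
      using Suc.prems(1) by simp
    show "frechet_derivative f (at p) w = frechet_derivative g (at p) w" if "p \<in> S" for p
      using frechet_derivative_at[OF d[OF that]] by simp
  qed
  then show ?case using d by (auto simp: differentiable_def)
qed

text \<open>The induction step for the closure properties: any
  explicit formula for the derivative may be used in place of \<^const>\<open>frechet_derivative\<close>.\<close>

lemma Ck_on_SucI:
  assumes "open S" "\<And>p. p \<in> S \<Longrightarrow> (f has_derivative f' p) (at p)"
    and "\<And>w. Ck_on k S (\<lambda>p. f' p w)"
  shows "Ck_on (Suc k) S f"
proof -
  have "Ck_on k S (\<lambda>p. frechet_derivative f (at p) w)" for w
    by (rule Ck_on_cong[OF assms(1) assms(3)[of w]]) (use assms(2) frechet_derivative_at in metis)
  then show ?thesis using assms(2) by (auto simp: differentiable_def)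
qed

lemma Ck_on_less: "Ck_on (Suc k) S f \<Longrightarrow> Ck_on k S f"
proof (induction k arbitrary: f)
  case 0
  then show ?case
    by (auto intro!: differentiable_imp_continuous_on simp: differentiable_on_def differentiable_at_withinI)
next
  case (Suc k)
  then show ?case by (metis Ck_on.simps(2))
qed

lemma Ck_on_subset: "Ck_on k S f \<Longrightarrow> T \<subseteq> S \<Longrightarrow> Ck_on k T f"
  by (induction k arbitrary: f) (auto intro: continuous_on_subset)

lemma Ck_on_const: "open S \<Longrightarrow> Ck_on k S (\<lambda>p. c)"
proof (induction k arbitrary: c)
  case (Suc k)
  show ?case by (rule Ck_on_SucI[where f'="\<lambda>_ _. 0"]) (use Suc in auto)
qed simp

lemma Ck_on_add:
  assumes "open S"
  shows "Ck_on k S f \<Longrightarrow> Ck_on k S g \<Longrightarrow> Ck_on k S (\<lambda>p. f p + g p)"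
proof (induction k arbitrary: f g)
  case (Suc k)
  show ?case
    by (rule Ck_on_SucI[OF assms has_derivative_add[OF Ck_on_SucD(1)[OF Suc.prems(1)] Ck_on_SucD(1)[OF Suc.prems(2)]]])
      (use Suc in auto)
qed (auto intro: continuous_intros)

lemma Ck_on_linear_compose:
  assumes "open S" "bounded_linear L"
  shows "Ck_on k S f \<Longrightarrow> Ck_on k S (\<lambda>p. L (f p))"
proof (induction k arbitrary: f)
  case 0
  then show ?case using bounded_linear.continuous_on[OF assms(2)] by auto
next
  case (Suc k)
  show ?case
    by (rule Ck_on_SucI[OF assms(1) bounded_linear.has_derivative[OF assms(2) Ck_on_SucD(1)[OF Suc.prems]]])
      (use Suc in auto)
qed

lemma Ck_on_sum:
  assumes "open S" "\<And>i. i \<in> I \<Longrightarrow> Ck_on k S (f i)"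
  shows "Ck_on k S (\<lambda>p. \<Sum>i\<in>I. f i p)"
  using assms(2)
proof (induction I rule: infinite_finite_induct)
  case (insert i I)
  then show ?case by (simp add: Ck_on_add[OF assms(1)])
qed (auto intro: Ck_on_const assms(1))

lemma Ck_on_scaleR:
  assumes "open S"
  shows "Ck_on k S c \<Longrightarrow> Ck_on k S f \<Longrightarrow> Ck_on k S (\<lambda>p. c p *\<^sub>R f p)"
proof (induction k arbitrary: c f)
  case (Suc k)
  note [simp] = Ck_on_less[OF Suc.prems(1)] Ck_on_less[OF Suc.prems(2)]
  show ?case
    by (rule Ck_on_SucI[OF assms has_derivative_scaleR[OF Ck_on_SucD(1)[OF Suc.prems(1)] Ck_on_SucD(1)[OF Suc.prems(2)]]])
      (use Suc.prems in \<open>auto intro!: Ck_on_add[OF assms] Suc.IH\<close>)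
qed (auto intro: continuous_intros)

lemma Ck_on_prod:
  fixes f :: "'i \<Rightarrow> 'a::real_normed_vector \<Rightarrow> real"
  assumes "open S" "\<And>i. i \<in> I \<Longrightarrow> Ck_on k S (f i)"
  shows "Ck_on k S (\<lambda>p. \<Prod>i\<in>I. f i p)"
  using assms(2)
proof (induction I rule: infinite_finite_induct)
  case (insert i I)
  then show ?case using Ck_on_scaleR[OF assms(1), of k "f i" "\<lambda>p. \<Prod>i\<in>I. f i p"] by simp
qed (auto intro: Ck_on_const assms(1))

lemma Ck_on_inverse:
  fixes f :: "'a::real_normed_vector \<Rightarrow> real"
  assumes "open S" "\<And>p. p \<in> S \<Longrightarrow> f p \<noteq> 0"
  shows "Ck_on k S f \<Longrightarrow> Ck_on k S (\<lambda>p. inverse (f p))"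
proof (induction k)
  case (Suc k)
  note IH = Suc.IH[OF Ck_on_less[OF Suc.prems]]
  show ?case
  proof (rule Ck_on_SucI[OF assms(1) Deriv.has_derivative_inverse[OF assms(2) Ck_on_SucD(1)[OF Suc.prems]]])
    fix w
    have "Ck_on k S (\<lambda>p. (- 1) *\<^sub>R (inverse (f p) *\<^sub>R (frechet_derivative f (at p) w *\<^sub>R inverse (f p))))"
      using Suc.prems IH by (intro Ck_on_scaleR[OF assms(1)] Ck_on_const[OF assms(1)]) auto
    then show "Ck_on k S (\<lambda>p. - (inverse (f p) * frechet_derivative f (at p) w * inverse (f p)))"
      by (simp add: mult.assoc)
  qed
qed (use assms(2) in \<open>auto intro: continuous_intros\<close>)

lemma linear_basis_expansion:
  fixes L :: "'a::euclidean_space \<Rightarrow> 'b::real_vector"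
  assumes "linear L"
  shows "L w = (\<Sum>b\<in>Basis. (w \<bullet> b) *\<^sub>R L b)"
  by (metis (no_types, lifting) assms euclidean_representation linear_scale linear_sum sum.cong)

text \<open>In the chain rule both the outer derivative and the direction it is applied to depend on the
  point.  Expanding the direction in a basis turns the derivative of the composite into a finite sum
  of products of maps with fixed directions, to which the induction hypothesis applies.\<close>

lemma Ck_on_compose:
  fixes g :: "'a::real_normed_vector \<Rightarrow> 'b::euclidean_space"
  assumes "open S" "open T" "g ` S \<subseteq> T"
  shows "Ck_on k T f \<Longrightarrow> Ck_on k S g \<Longrightarrow> Ck_on k S (\<lambda>p. f (g p))"
proof (induction k arbitrary: f)
  case 0
  then show ?case using assms(3) continuous_on_compose2 by auto
next
  case (Suc k)
  have der: "((\<lambda>p. f (g p)) has_derivative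
      (\<lambda>w. frechet_derivative f (at (g p)) (frechet_derivative g (at p) w))) (at p)" if "p \<in> S" for p
    using has_derivative_compose[OF Ck_on_SucD(1)[OF Suc.prems(2) that] Ck_on_SucD(1)[OF Suc.prems(1)]] that assms(3)
    by (auto simp: image_subset_iff)
  have expand: "frechet_derivative f (at (g p)) z =
      (\<Sum>b\<in>Basis. (z \<bullet> b) *\<^sub>R frechet_derivative f (at (g p)) b)" if "p \<in> S" for p z
    by (intro linear_basis_expansion has_derivative_linear[OF Ck_on_SucD(1)[OF Suc.prems(1)]])
      (use that assms(3) in auto)
  have "Ck_on k S (\<lambda>p. \<Sum>b\<in>Basis. (frechet_derivative g (at p) w \<bullet> b) *\<^sub>R frechet_derivative f (at (g p)) b)" for w
    using Suc.prems(1,2) Suc.IH[OF _ Ck_on_less[OF Suc.prems(2)]]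
    by (intro Ck_on_sum Ck_on_scaleR assms(1) Ck_on_linear_compose[of _ "\<lambda>z. z \<bullet> b" for b])
      (auto intro: bounded_linear_intros)
  then have "Ck_on k S (\<lambda>p. frechet_derivative f (at (g p)) (frechet_derivative g (at p) w))" for w
    by (rule Ck_on_cong[OF assms(1)]) (use expand in auto)
  with der show ?case
    by (intro Ck_on_SucI[OF assms(1), where f'="\<lambda>p w. frechet_derivative f (at (g p)) (frechet_derivative g (at p) w)"])
qed

lemma smooth_on_has_derivative:
  "smooth_on S f \<Longrightarrow> p \<in> S \<Longrightarrow> (f has_derivative frechet_derivative f (at p)) (at p)"
  unfolding smooth_on_def using Ck_on_SucD(1) by blast

lemma smooth_on_derivative:
  "smooth_on S f \<Longrightarrow> smooth_on S (\<lambda>p. frechet_derivative f (at p) w)"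
  unfolding smooth_on_def by (metis Ck_on.simps(2))

lemma smooth_on_continuous: "smooth_on S f \<Longrightarrow> continuous_on S f"
  unfolding smooth_on_def by (metis Ck_on.simps(1))

lemma smooth_on_subset: "smooth_on S f \<Longrightarrow> T \<subseteq> S \<Longrightarrow> smooth_on T f"
  unfolding smooth_on_def using Ck_on_subset by blast

lemma smooth_on_linear_compose:
  "open S \<Longrightarrow> bounded_linear L \<Longrightarrow> smooth_on S f \<Longrightarrow> smooth_on S (\<lambda>p. L (f p))"
  unfolding smooth_on_def using Ck_on_linear_compose by blast

lemma smooth_on_const: "open S \<Longrightarrow> smooth_on S (\<lambda>p. c)"
  unfolding smooth_on_def using Ck_on_const by blast

lemma smooth_on_scaleR:
  "open S \<Longrightarrow> smooth_on S c \<Longrightarrow> smooth_on S f \<Longrightarrow> smooth_on S (\<lambda>p. c p *\<^sub>R f p)"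
  unfolding smooth_on_def using Ck_on_scaleR by blast

lemma smooth_on_inverse:
  fixes f :: "'a::real_normed_vector \<Rightarrow> real"
  shows "open S \<Longrightarrow> (\<And>p. p \<in> S \<Longrightarrow> f p \<noteq> 0) \<Longrightarrow> smooth_on S f \<Longrightarrow> smooth_on S (\<lambda>p. inverse (f p))"
  unfolding smooth_on_def using Ck_on_inverse by blast

lemma smooth_on_compose:
  fixes g :: "'a::real_normed_vector \<Rightarrow> 'b::euclidean_space"
  shows "open S \<Longrightarrow> open T \<Longrightarrow> g ` S \<subseteq> T \<Longrightarrow> smooth_on T f \<Longrightarrow> smooth_on S g
    \<Longrightarrow> smooth_on S (\<lambda>p. f (g p))"
  unfolding smooth_on_def using Ck_on_compose by blast

section \<open>The smooth inverse function theorem\<close>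

lemma Ck_on_vec:
  fixes f :: "'a::real_normed_vector \<Rightarrow> real^'n"
  assumes "open S" "\<And>i. Ck_on k S (\<lambda>p. f p $ i)"
  shows "Ck_on k S f"
proof (rule Ck_on_cong[OF assms(1)])
  show "Ck_on k S (\<lambda>p. \<Sum>i\<in>UNIV. f p $ i *\<^sub>R axis i 1)"
    by (intro Ck_on_sum Ck_on_scaleR Ck_on_const assms)
  show "(\<Sum>i\<in>UNIV. f p $ i *\<^sub>R axis i 1) = f p" for p
    using basis_expansion[of "f p"] by (simp add: scalar_mult_eq_scaleR)
qed

lemma Ck_on_det:
  fixes A :: "'a::real_normed_vector \<Rightarrow> real^'n^'n"
  assumes "open S" "\<And>i j. Ck_on k S (\<lambda>p. A p $ i $ j)"
  shows "Ck_on k S (\<lambda>p. det (A p))"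
proof -
  have "Ck_on k S (\<lambda>p. \<Sum>\<pi>\<in>{\<pi>. \<pi> permutes UNIV}. real_of_int (sign \<pi>) *\<^sub>R (\<Prod>i\<in>UNIV. A p $ i $ \<pi> i))"
    by (intro Ck_on_sum Ck_on_scaleR Ck_on_const Ck_on_prod assms)
  then show ?thesis by (simp add: det_def)
qed

text \<open>By Cramer's rule the solution of a regular linear system is a rational function of its
  coefficients, hence as differentiable as they are.\<close>

lemma Ck_on_linear_solution:
  fixes A :: "'a::real_normed_vector \<Rightarrow> real^'n^'n"
  assumes "open S" "\<And>i j. Ck_on k S (\<lambda>p. A p $ i $ j)"
    and "\<And>p. p \<in> S \<Longrightarrow> det (A p) \<noteq> 0" "\<And>p. p \<in> S \<Longrightarrow> A p *v y p = b"
  shows "Ck_on k S y"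
proof (rule Ck_on_cong[OF assms(1)])
  have "Ck_on k S (\<lambda>p. if j = m then b $ i else A p $ i $ j)" for i j m
    by (cases "j = m") (simp_all add: Ck_on_const assms)
  then have "Ck_on k S (\<lambda>p. det (\<chi> i j. if j = m then b $ i else A p $ i $ j) *\<^sub>R inverse (det (A p)))" for m
    by (intro Ck_on_scaleR Ck_on_inverse Ck_on_det assms) auto
  then show "Ck_on k S (\<lambda>p. \<chi> m. det (\<chi> i j. if j = m then b $ i else A p $ i $ j) / det (A p))"
    by (intro Ck_on_vec[OF assms(1)]) (simp add: divide_inverse)
  show "(\<chi> m. det (\<chi> i j. if j = m then b $ i else A p $ i $ j) / det (A p)) = y p" if "p \<in> S" for p
    using cramer[OF assms(3)[OF that], of "y p" b] assms(4)[OF that] by simp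
qed

text \<open>The derivative of the local inverse \<open>g\<close> at \<open>y\<close> solves a linear system whose coefficients are
  first derivatives of \<open>f\<close> at \<open>g y\<close>.  So if \<open>g\<close> is of class \<open>C\<^sup>k\<close>, its derivative is too, and
  \<open>g\<close> gains one order at each step.\<close>

theorem smooth_inverse_function_theorem:
  fixes f :: "real^'n \<Rightarrow> real^'n"
  assumes U: "open U" "p \<in> U" and f: "smooth_on U f" and inj: "inj (frechet_derivative f (at p))"
  obtains S T g where "open S" "p \<in> S" "S \<subseteq> U" "open T" "homeomorphism S T f g" "smooth_on T g"
proof -
  define f' where "f' q = Blinfun (frechet_derivative f (at q))" for q
  have f': "blinfun_apply (f' q) = frechet_derivative f (at q)" if "q \<in> U" for q
    unfolding f'_def using smooth_on_has_derivative[OF f that]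
    by (intro bounded_linear_Blinfun_apply has_derivative_bounded_linear)
  obtain L where L: "linear L" "L \<circ> frechet_derivative f (at p) = id"
    using linear_injective_left_inverse[OF has_derivative_linear[OF smooth_on_has_derivative[OF f U(2)]] inj] by blast
  have der: "(f has_derivative blinfun_apply (f' q)) (at q)" if "q \<in> U" for q
    using smooth_on_has_derivative[OF f that] f'[OF that] by simp
  have "continuous_on U (\<lambda>q. blinfun_apply (f' q) b)" for b
    using smooth_on_continuous[OF smooth_on_derivative[OF f, of b]] by (rule continuous_on_eq) (simp add: f')
  then have cont: "continuous_on U f'" by (intro continuous_on_blinfun_componentwise)
  have inv: "Blinfun L o\<^sub>L f' p = id_blinfun"
    using L U by (intro blinfun_eqI)
      (simp add: f' bounded_linear_Blinfun_apply linear_conv_bounded_linear pointfree_idE)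
  obtain S T g g' where S: "open S" "S \<subseteq> U" "p \<in> S" and T: "open T" and hom: "homeomorphism S T f g"
    and g': "\<And>y. y \<in> T \<Longrightarrow> (g has_derivative (g' y)) (at y)"
      "\<And>y. y \<in> T \<Longrightarrow> g' y = inv (blinfun_apply (f'(g y)))"
      "\<And>y. y \<in> T \<Longrightarrow> bij (blinfun_apply (f'(g y)))"
    by (rule inverse_function_theorem[OF U(1) der cont U(2) inv]) blast+
  have gU: "g y \<in> U" if "y \<in> T" for y using homeomorphism_image2[OF hom] S(2) that by auto
  have bij: "bij (frechet_derivative f (at (g y)))" if "y \<in> T" for y
    using g'(3)[OF that] f'[OF gU[OF that]] by simp
  have lin: "linear (frechet_derivative f (at (g y)))" if "y \<in> T" for y
    using has_derivative_linear[OF smooth_on_has_derivative[OF f gU[OF that]]] .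
  have "Ck_on k T g" for k
  proof (induction k)
    case 0
    show ?case using homeomorphism_cont2[OF hom] by simp
  next
    case (Suc k)
    show ?case
    proof (rule Ck_on_SucI[OF T g'(1)])
      fix w
      show "Ck_on k T (\<lambda>y. g' y w)"
      proof (rule Ck_on_linear_solution[where A="\<lambda>y. matrix (frechet_derivative f (at (g y)))" and b=w])
        fix i j :: 'n
        have "Ck_on k U (\<lambda>q. frechet_derivative f (at q) (axis j 1) $ i)"
          using smooth_on_derivative[OF f, of "axis j 1"] unfolding smooth_on_def
          by (intro Ck_on_linear_compose[OF U(1) bounded_linear_vec_nth[of i]]) blast
        from Ck_on_compose[OF T U(1) _ this Suc] gU
        show "Ck_on k T (\<lambda>y. matrix (frechet_derivative f (at (g y))) $ i $ j)"
          by (auto simp: matrix_def)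
      next
        fix y assume y: "y \<in> T"
        show "det (matrix (frechet_derivative f (at (g y)))) \<noteq> 0"
          using det_nz_iff_inj[OF lin[OF y]] bij[OF y] by (simp add: bij_is_inj)
        show "matrix (frechet_derivative f (at (g y))) *v g' y w = w"
          using bij[OF y] by (simp add: matrix_works lin[OF y] g'(2)[OF y] f'[OF gU[OF y]] bij_is_surj surj_f_inv_f)
      qed (rule T)
    qed
  qed
  then show ?thesis using that[OF S(1,3,2) T hom] by (simp add: smooth_on_def)
qed

lemma inj_derivative_of_invertible:
  assumes "(\<phi> has_derivative D) (at p)" "(\<psi> has_derivative E) (at (\<phi> p))"
    and "open T" "p \<in> T" "\<And>y. y \<in> T \<Longrightarrow> \<psi> (\<phi> y) = y"
  shows "inj D"
proof (rule inj_on_inverseI)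
  have "((\<lambda>y. \<psi> (\<phi> y)) has_derivative (\<lambda>w. E (D w))) (at p)"
    by (rule has_derivative_compose[OF assms(1,2)])
  then have "((\<lambda>y. y) has_derivative (\<lambda>w. E (D w))) (at p)"
    using assms(3-5) by (rule has_derivative_transform_within_open)
  then have "(\<lambda>w. E (D w)) = (\<lambda>w. w)" by (rule has_derivative_unique) (rule has_derivative_ident)
  then show "E (D w) = w" for w by meson
qed

section \<open>Second derivatives: symmetry and convexity\<close>

lemma has_real_derivative_along_line:
  fixes f :: "'a::real_normed_vector \<Rightarrow> real"
  assumes "(f has_derivative D) (at (q + t *\<^sub>R a))"
  shows "((\<lambda>t. f (q + t *\<^sub>R a)) has_real_derivative D a) (at t)"
proof -
  have "((\<lambda>t. f (q + t *\<^sub>R a)) has_derivative (\<lambda>s. D (s *\<^sub>R a))) (at t)"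
    by (rule has_derivative_compose[where g=f and f="\<lambda>t. q + t *\<^sub>R a", OF _ assms]) (auto intro!: derivative_eq_intros)
  moreover have "D (s *\<^sub>R a) = D a * s" for s
    by (simp add: linear_scale has_derivative_linear[OF assms])
  ultimately show ?thesis by (simp add: has_field_derivative_def)
qed

text \<open>The mean value theorem, applied first in direction \<open>a\<close> to a difference in direction \<open>b\<close> and then
  in direction \<open>b\<close>.  The second difference on the left is symmetric in \<open>a\<close> and \<open>b\<close>, which is why the
  two mixed derivatives must agree.\<close>

lemma second_difference_mean_value:
  fixes f :: "'a::real_normed_vector \<Rightarrow> real"
  assumes f: "Ck_on (Suc (Suc 0)) S f" and s: "s > 0"
    and inS: "\<And>t t'. 0 \<le> t \<Longrightarrow> t \<le> s \<Longrightarrow> 0 \<le> t' \<Longrightarrow> t' \<le> s \<Longrightarrow> p + t *\<^sub>R a + t' *\<^sub>R b \<in> S"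
  shows "\<exists>t t'. 0 < t \<and> t < s \<and> 0 < t' \<and> t' < s \<and>
     f (p + s *\<^sub>R a + s *\<^sub>R b) - f (p + s *\<^sub>R a) - f (p + s *\<^sub>R b) + f p =
     s * s * frechet_derivative (\<lambda>q. frechet_derivative f (at q) a) (at (p + t *\<^sub>R a + t' *\<^sub>R b)) b"
proof -
  define D where "D q = frechet_derivative f (at q) a" for q
  have f1: "((\<lambda>t. f (p + t *\<^sub>R a + t' *\<^sub>R b)) has_real_derivative D (p + t *\<^sub>R a + t' *\<^sub>R b)) (at t)"
    if "0 \<le> t" "t \<le> s" "0 \<le> t'" "t' \<le> s" for t t'
    using has_real_derivative_along_line[of f _ "p + t' *\<^sub>R b" t a] Ck_on_SucD(1)[OF f inS[OF that]]
    by (simp add: D_def algebra_simps)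
  have "\<exists>t. 0 < t \<and> t < s \<and>
    (f (p + s *\<^sub>R a + s *\<^sub>R b) - f (p + s *\<^sub>R a + 0 *\<^sub>R b)) - (f (p + 0 *\<^sub>R a + s *\<^sub>R b) - f (p + 0 *\<^sub>R a + 0 *\<^sub>R b))
      = (s - 0) * (D (p + t *\<^sub>R a + s *\<^sub>R b) - D (p + t *\<^sub>R a + 0 *\<^sub>R b))"
    by (rule MVT2[OF s]) (intro DERIV_diff f1; use s in simp)
  then obtain t where t: "0 < t" "t < s" and 1:
    "f (p + s *\<^sub>R a + s *\<^sub>R b) - f (p + s *\<^sub>R a) - (f (p + s *\<^sub>R b) - f p)
      = s * (D (p + t *\<^sub>R a + s *\<^sub>R b) - D (p + t *\<^sub>R a + 0 *\<^sub>R b))"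
    by auto
  have D1: "(D has_derivative frechet_derivative D (at q)) (at q)" if "q \<in> S" for q
    using Ck_on_SucD(1)[OF Ck_on_SucD(2)[OF f that] that] by (simp add: D_def[abs_def])
  have "\<exists>t'. 0 < t' \<and> t' < s \<and> D (p + t *\<^sub>R a + s *\<^sub>R b) - D (p + t *\<^sub>R a + 0 *\<^sub>R b)
     = (s - 0) * frechet_derivative D (at (p + t *\<^sub>R a + t' *\<^sub>R b)) b"
    by (rule MVT2[OF s]) (intro has_real_derivative_along_line D1 inS; use t in simp)
  then obtain t' where "0 < t'" "t' < s" "D (p + t *\<^sub>R a + s *\<^sub>R b) - D (p + t *\<^sub>R a + 0 *\<^sub>R b)
     = s * frechet_derivative D (at (p + t *\<^sub>R a + t' *\<^sub>R b)) b"
    by auto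
  with t 1 show ?thesis
    by (intro exI[of _ t] exI[of _ t']) (simp add: D_def[abs_def] algebra_simps)
qed

lemma mixed_second_derivatives_commute:
  fixes f :: "'a::real_normed_vector \<Rightarrow> real"
  assumes "open S" "p \<in> S" and f: "Ck_on (Suc (Suc 0)) S f"
  shows "frechet_derivative (\<lambda>q. frechet_derivative f (at q) a) (at p) b
       = frechet_derivative (\<lambda>q. frechet_derivative f (at q) b) (at p) a"
proof (rule ccontr)
  define D where "D a b q = frechet_derivative (\<lambda>q. frechet_derivative f (at q) a) (at q) b" for a b q
  assume "\<not> ?thesis"
  then have e: "\<bar>D a b p - D b a p\<bar> / 2 > 0" (is "?e > 0") by (simp add: D_def)
  have "(D a b \<longlongrightarrow> D a b p) (nhds p)" for a b
  proof -
    have "continuous_on S (D a b)" using f by (simp add: D_def[abs_def])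
    then show ?thesis using assms(1,2) continuous_on_eq_continuous_at
      by (metis continuous_at tendsto_at_iff_tendsto_nhds)
  qed
  then have "\<forall>\<^sub>F q in nhds p. dist (D a b q) (D a b p) < ?e" for a b
    using e tendstoD by blast
  moreover have "\<forall>\<^sub>F q in nhds p. q \<in> S" using assms(1,2) eventually_nhds_in_open by blast
  ultimately have "\<forall>\<^sub>F q in nhds p. q \<in> S \<and> dist (D a b q) (D a b p) < ?e \<and> dist (D b a q) (D b a p) < ?e"
    by (intro eventually_conj)
  then obtain \<delta> where \<delta>: "\<delta> > 0" and close: "\<And>q. dist q p < \<delta> \<Longrightarrow>
      q \<in> S \<and> dist (D a b q) (D a b p) < ?e \<and> dist (D b a q) (D b a p) < ?e"
    by (auto simp: eventually_nhds_metric)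
  \<comment> \<open>The parallelogram with sides \<open>s a\<close> and \<open>s b\<close> fits into the ball of radius \<open>\<delta>\<close>.\<close>
  define s where "s = \<delta> / (norm a + norm b + 1)"
  have "norm a + norm b + 1 > 0" using norm_ge_zero[of a] norm_ge_zero[of b] by linarith
  then have s: "s > 0" "s * (norm a + norm b) < \<delta>"
    using \<delta> by (auto simp: s_def field_simps)
  have near: "dist (p + t *\<^sub>R a + t' *\<^sub>R b) p < \<delta>" "dist (p + t *\<^sub>R b + t' *\<^sub>R a) p < \<delta>"
    if "0 \<le> t" "t \<le> s" "0 \<le> t'" "t' \<le> s" for t t'
  proof -
    have "norm (t *\<^sub>R a + t' *\<^sub>R b) \<le> s * (norm a + norm b)" "norm (t *\<^sub>R b + t' *\<^sub>R a) \<le> s * (norm a + norm b)"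
      using that norm_triangle_ineq[of "t *\<^sub>R a" "t' *\<^sub>R b"] norm_triangle_ineq[of "t *\<^sub>R b" "t' *\<^sub>R a"]
        mult_right_mono[of t s "norm a"] mult_right_mono[of t' s "norm b"]
        mult_right_mono[of t s "norm b"] mult_right_mono[of t' s "norm a"]
      by (simp_all add: distrib_left)
    then show "dist (p + t *\<^sub>R a + t' *\<^sub>R b) p < \<delta>" "dist (p + t *\<^sub>R b + t' *\<^sub>R a) p < \<delta>"
      using s(2) by (auto simp: dist_norm add.assoc)
  qed
  obtain t t' where 1: "0 < t" "t < s" "0 < t'" "t' < s"
    "f (p + s *\<^sub>R a + s *\<^sub>R b) - f (p + s *\<^sub>R a) - f (p + s *\<^sub>R b) + f p = s * s * D a b (p + t *\<^sub>R a + t' *\<^sub>R b)"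
    using second_difference_mean_value[OF f s(1), of p a b] close near unfolding D_def by meson
  obtain r r' where 2: "0 < r" "r < s" "0 < r'" "r' < s"
    "f (p + s *\<^sub>R b + s *\<^sub>R a) - f (p + s *\<^sub>R b) - f (p + s *\<^sub>R a) + f p = s * s * D b a (p + r *\<^sub>R b + r' *\<^sub>R a)"
    using second_difference_mean_value[OF f s(1), of p b a] close near unfolding D_def by meson
  have comm: "p + s *\<^sub>R b + s *\<^sub>R a = p + s *\<^sub>R a + s *\<^sub>R b" by (simp add: add_ac)
  have "s * s * D a b (p + t *\<^sub>R a + t' *\<^sub>R b) = s * s * D b a (p + r *\<^sub>R b + r' *\<^sub>R a)"
    using 1(5) 2(5)[unfolded comm] by linarith
  then have eq: "D a b (p + t *\<^sub>R a + t' *\<^sub>R b) = D b a (p + r *\<^sub>R b + r' *\<^sub>R a)" using s by simp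
  have "dist (D a b (p + t *\<^sub>R a + t' *\<^sub>R b)) (D a b p) < ?e" "dist (D b a (p + r *\<^sub>R b + r' *\<^sub>R a)) (D b a p) < ?e"
    using close near 1 2 by auto
  from dist_triangle_half_r[OF this(1) this(2)[folded eq]] show False by (simp add: dist_real_def)
qed

text \<open>Restricting to segments reduces the claim to functions of one variable.\<close>

lemma convex_on_second_derivative_nonneg:
  fixes h :: "'a::real_normed_vector \<Rightarrow> real"
  assumes "convex W"
    and 1: "\<And>p. p \<in> W \<Longrightarrow> (h has_derivative h' p) (at p)"
    and 2: "\<And>p w. p \<in> W \<Longrightarrow> ((\<lambda>q. h' q w) has_derivative h'' p w) (at p)"
    and 3: "\<And>p w. p \<in> W \<Longrightarrow> h'' p w w \<ge> 0"
  shows "convex_on W h"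
proof (rule convex_onI[OF _ assms(1)])
  fix t :: real and p q assume t: "0 < t" "t < 1" and pq: "p \<in> W" "q \<in> W"
  have line: "p + s *\<^sub>R (q - p) \<in> W" if "s \<in> {0..1}" for s
    using convexD_alt[OF assms(1) pq, of s] that by (simp add: algebra_simps)
  have "convex_on {0..1} (\<lambda>s. h (p + s *\<^sub>R (q - p)))"
    by (rule f''_ge0_imp_convex[where f'="\<lambda>s. h' (p + s *\<^sub>R (q - p)) (q - p)"
          and f''="\<lambda>s. h'' (p + s *\<^sub>R (q - p)) (q - p) (q - p)"])
      (use 3 line has_real_derivative_along_line[of h _ p _ "q - p", OF 1]
        has_real_derivative_along_line[of "\<lambda>q'. h' q' (q - p)" _ p _ "q - p", OF 2] in auto)
  from convex_onD[OF this, of t 0 1] t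
  show "h ((1 - t) *\<^sub>R p + t *\<^sub>R q) \<le> (1 - t) * h p + t * h q"
    by (simp add: algebra_simps)
qed

section \<open>A generalized eigenvalue problem\<close>

text \<open>A zero of a nonnegative quadratic form is a minimum, so the gradient of the form vanishes there.
  The proof moves from \<open>w\<close> a short way against the direction \<open>M w\<close>.\<close>

lemma null_vector_of_semidefinite:
  fixes M :: "'a::real_inner \<Rightarrow> 'a"
  assumes M: "linear M" and sym: "\<And>z w. M z \<bullet> w = z \<bullet> M w"
    and nonneg: "\<And>z. M z \<bullet> z \<ge> 0" and w: "M w \<bullet> w = 0"
  shows "M w = 0"
proof (rule ccontr)
  assume "M w \<noteq> 0"
  define z where "z = M w"
  define B where "B = M z \<bullet> z"
  have A: "z \<bullet> z > 0" and B: "B \<ge> 0" using \<open>M w \<noteq> 0\<close> nonneg by (auto simp: z_def B_def)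
  \<comment> \<open>Along \<open>w - s z\<close> the form is \<open>s (s B - 2 (z \<bullet> z))\<close>, which is negative for this \<open>s\<close>.\<close>
  define s where "s = (z \<bullet> z) / (B + 1)"
  have s: "s > 0" "s * B < z \<bullet> z" using A B by (auto simp: s_def field_simps)
  have "0 \<le> M (w - s *\<^sub>R z) \<bullet> (w - s *\<^sub>R z)" by (rule nonneg)
  also have "\<dots> = s * (s * B - 2 * (z \<bullet> z))"
    using sym[of z w] w
    by (simp add: linear_diff[OF M] linear_scale[OF M] inner_diff_left inner_diff_right B_def
        inner_commute z_def[symmetric] algebra_simps)
  also have "\<dots> < 0" using s A by (intro mult_pos_neg) linarith+
  finally show False by simp
qed

text \<open>The maximum of the Rayleigh quotient of \<open>H\<close> and \<open>S\<close> is a generalized eigenvalue, and it is positive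
  as soon as the form of \<open>H\<close> takes a positive value.\<close>

lemma generalized_eigenvector:
  fixes H S :: "'a::euclidean_space \<Rightarrow> 'a"
  assumes H: "linear H" "\<And>z w. H z \<bullet> w = z \<bullet> H w"
    and S: "linear S" "\<And>z w. S z \<bullet> w = z \<bullet> S w" "\<And>w. w \<noteq> 0 \<Longrightarrow> S w \<bullet> w > 0"
    and z: "H z \<bullet> z > 0"
  obtains l w where "l > 0" "w \<noteq> 0" "H w = l *\<^sub>R S w"
proof -
  define R where "R w = (H w \<bullet> w) / (S w \<bullet> w)" for w
  have z0: "z \<noteq> 0" using z linear_0[OF H(1)] by auto
  have "continuous_on (sphere 0 1) R" unfolding R_def
    using linear_continuous_on_compose[OF continuous_on_id H(1), of "sphere 0 1"]
      linear_continuous_on_compose[OF continuous_on_id S(1), of "sphere 0 1"] S(3)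
    by (auto intro!: continuous_intros) (metis S(3) norm_zero zero_neq_one less_irrefl)
  moreover have "(1 / norm z) *\<^sub>R z \<in> sphere 0 1" using z0 by simp
  ultimately obtain w where w: "norm w = 1" and max: "\<And>y. norm y = 1 \<Longrightarrow> R y \<le> R w"
    using continuous_attains_sup[of "sphere 0 1" R] by fastforce
  have scale: "R (c *\<^sub>R y) = R y" if "c \<noteq> 0" for c y
    using that by (simp add: R_def linear_scale[OF H(1)] linear_scale[OF S(1)])
  have le: "R y \<le> R w" if "y \<noteq> 0" for y
    using max[of "(1 / norm y) *\<^sub>R y"] scale[of "1 / norm y" y] that by simp
  have "R z > 0" using z S(3)[OF z0] by (simp add: R_def)
  then have pos: "R w > 0" using le[OF z0] by simp
  have w0: "w \<noteq> 0" using w by auto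
  have "R w *\<^sub>R S w - H w = 0"
  proof (rule null_vector_of_semidefinite[where M="\<lambda>y. R w *\<^sub>R S y - H y"])
    show "linear (\<lambda>y. R w *\<^sub>R S y - H y)"
      by (intro linear_compose_sub linear_compose_scale_right H S)
    show "(R w *\<^sub>R S y - H y) \<bullet> v = y \<bullet> (R w *\<^sub>R S v - H v)" for y v
      by (simp add: inner_diff_left inner_diff_right H(2) S(2))
    show "(R w *\<^sub>R S y - H y) \<bullet> y \<ge> 0" for y
      using le[of y] S(3)[of y] linear_0[OF S(1)] linear_0[OF H(1)]
      by (cases "y = 0") (auto simp: inner_diff_left R_def[of y] field_simps)
    show "(R w *\<^sub>R S w - H w) \<bullet> w = 0"
      using S(3)[OF w0] by (simp add: inner_diff_left R_def)
  qed
  then show ?thesis using that[OF pos w0] by simp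
qed

section \<open>Projection to the plane and derivatives of unit fields\<close>

definition planar :: "real^3 \<Rightarrow> real^2" where
  "planar y = vector [y $ 1, y $ 2]"

lemma planar_nth [simp]: "planar y $ 1 = y $ 1" "planar y $ 2 = y $ 2"
  by (simp_all add: planar_def)

lemma bounded_linear_planar: "bounded_linear planar"
  by (intro linear_conv_bounded_linear[THEN iffD1] linearI) (simp_all add: vec_eq_iff forall_2)

lemmas planar_linear [simp] =
  linear_add[OF bounded_linear.linear[OF bounded_linear_planar]]
  linear_scale[OF bounded_linear.linear[OF bounded_linear_planar]]

lemma norm_planar_le: "norm (planar y) \<le> norm y"
  by (simp add: norm_le inner_vec_def sum_2 sum_3)

lemma vec3_eq_0_iff: "y = 0 \<longleftrightarrow> planar y = 0 \<and> y $ 3 = (0::real)"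
  by (auto simp: vec_eq_iff forall_2 forall_3)

lemma inner_eq_planar: "a \<bullet> b = planar a \<bullet> planar b + a $ 3 * b $ 3"
  by (simp add: inner_vec_def sum_2 sum_3)

lemma linear_axis_expansion:
  fixes L :: "real^2 \<Rightarrow> 'b::real_vector"
  assumes "linear L"
  shows "L w = w $ 1 *\<^sub>R L (axis 1 1) + w $ 2 *\<^sub>R L (axis 2 1)"
proof -
  have "w = w $ 1 *\<^sub>R axis 1 1 + w $ 2 *\<^sub>R axis 2 1"
    by (simp add: vec_eq_iff forall_2 axis_def)
  then have "L w = L (w $ 1 *\<^sub>R axis 1 1 + w $ 2 *\<^sub>R axis 2 1)" by simp
  then show ?thesis by (simp only: linear_add[OF assms] linear_scale[OF assms])
qed

lemma rank_jacobian_full_iff_inj: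
  fixes f :: "real^'m \<Rightarrow> real^'k"
  assumes "(f has_derivative D) (at q)"
  shows "rank (jacobian f (at q)) = CARD('m) \<longleftrightarrow> inj D"
proof -
  have "(*v) (matrix D) = D" using matrix_vector_mul(2)[OF has_derivative_linear[OF assms]] by simp
  then show ?thesis
    by (simp add: jacobian_def full_rank_injective frechet_derivative_at[OF assms, symmetric])
qed

lemma unit_field_orthogonal_derivative:
  fixes n :: "'a::real_normed_vector \<Rightarrow> 'b::real_inner"
  assumes "open U" "q \<in> U" "\<And>y. y \<in> U \<Longrightarrow> norm (n y) = 1" "(n has_derivative D) (at q)"
  shows "n q \<bullet> D w = 0"
proof -
  have "((\<lambda>y. n y \<bullet> n y) has_derivative (\<lambda>w. n q \<bullet> D w + D w \<bullet> n q)) (at q)"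
    using has_derivative_inner[OF assms(4,4)] .
  then have "((\<lambda>y. 1) has_derivative (\<lambda>w. n q \<bullet> D w + D w \<bullet> n q)) (at q)"
    using assms(1,2) by (rule has_derivative_transform_within_open) (simp add: assms(3) dot_square_norm)
  then have "(\<lambda>w. n q \<bullet> D w + D w \<bullet> n q) = (\<lambda>w. 0)" by (rule has_derivative_unique) simp
  from fun_cong[OF this, of w] show ?thesis by (simp add: inner_commute)
qed

lemma unit_normal_on_orthogonal:
  assumes "unit_normal_on U x n" "q \<in> U" "x differentiable (at q)"
  shows "n q \<bullet> frechet_derivative x (at q) w = 0"
  using assms(1,2) linear_axis_expansion[OF linear_frechet_derivative[OF assms(3)], of w]
  unfolding unit_normal_on_def partial_def by (simp add: inner_add_right)

section \<open>The slopes of the tangent planes as coordinates\<close>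

text \<open>If \<open>n\<close> is normal to the graph of a function, then the function has gradient
  \<open>- planar n / n\<^sub>3\<close>, so the chart \<open>\<nu>\<close> records the slope of the tangent plane.  It is a chart
  because a unit field moves orthogonally to itself: at the vertical vector \<open>n 0\<close> all of its motion is
  seen by the projection.\<close>

lemma slope_coordinates:
  fixes n :: "real^2 \<Rightarrow> real^3"
  assumes U: "open U" "0 \<in> U" and n: "smooth_on U n" and unit: "\<And>q. q \<in> U \<Longrightarrow> norm (n q) = 1"
    and n0: "n 0 = axis 3 1" and inj: "inj (frechet_derivative n (at 0))"
  obtains S T \<nu> \<phi> where "open S" "0 \<in> S" "S \<subseteq> U" "open T" "0 \<in> T" "homeomorphism S T \<nu> \<phi>"
    "smooth_on S \<nu>" "smooth_on T \<phi>" "\<phi> 0 = 0"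
    "\<And>p. p \<in> T \<Longrightarrow> n (\<phi> p) $ 3 > 0" "\<And>p. p \<in> T \<Longrightarrow> planar (n (\<phi> p)) = - (n (\<phi> p) $ 3 *\<^sub>R p)"
proof -
  define U0 where "U0 = {q \<in> U. n q $ 3 > 0}"
  define \<nu> where "\<nu> q = (- inverse (n q $ 3)) *\<^sub>R planar (n q)" for q
  have "open (U \<inter> (\<lambda>q. n q $ 3) -` {0<..})"
    by (intro continuous_open_preimage continuous_intros smooth_on_continuous[OF n] U)
  then have U0: "open U0" "U0 \<subseteq> U" by (auto simp: U0_def Int_def vimage_def)
  have pl0: "planar (n 0) = 0" by (simp add: n0 vec_eq_iff forall_2 axis_def)
  have 0: "0 \<in> U0" "\<nu> 0 = 0" using U(2) pl0 by (simp_all add: U0_def \<nu>_def n0 axis_def)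
  have n3: "smooth_on U0 (\<lambda>q. n q $ 3)"
    using smooth_on_linear_compose[OF U0(1) bounded_linear_vec_nth smooth_on_subset[OF n U0(2)]] .
  have "smooth_on U0 (\<lambda>q. (- 1) *\<^sub>R inverse (n q $ 3))"
    by (intro smooth_on_scaleR smooth_on_inverse smooth_on_const U0(1) n3) (auto simp: U0_def)
  then have \<nu>: "smooth_on U0 \<nu>" unfolding \<nu>_def
    by (intro smooth_on_scaleR smooth_on_linear_compose[OF U0(1) bounded_linear_planar] U0(1) smooth_on_subset[OF n U0(2)]) simp
  define D where "D = frechet_derivative n (at 0)"
  have D: "(n has_derivative D) (at 0)" unfolding D_def by (rule smooth_on_has_derivative[OF n U(2)])
  \<comment> \<open>Since \<open>planar (n 0) = 0\<close>, differentiating the factor \<open>- inverse (n q $ 3)\<close> contributes nothing.\<close>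
  have "((\<lambda>q. - inverse (n q $ 3)) has_derivative
      (\<lambda>w. - (- (inverse (n 0 $ 3) * (D w $ 3) * inverse (n 0 $ 3))))) (at 0)"
    by (intro has_derivative_minus Deriv.has_derivative_inverse bounded_linear.has_derivative[OF bounded_linear_vec_nth] D)
      (simp add: n0 axis_def)
  from has_derivative_scaleR[OF this bounded_linear.has_derivative[OF bounded_linear_planar D]]
  have D\<nu>: "(\<nu> has_derivative (\<lambda>w. - planar (D w))) (at 0)"
    by (simp add: \<nu>_def[abs_def] pl0[unfolded n0] n0)
  have "inj (\<lambda>w. - planar (D w))"
  proof (subst linear_inj_iff_eq_0[OF has_derivative_linear[OF D\<nu>]], intro allI impI)
    fix w assume "- planar (D w) = 0"
    moreover have "n 0 \<bullet> D w = 0" by (rule unit_field_orthogonal_derivative[OF U unit D])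
    ultimately have "D w = 0" by (simp add: vec3_eq_0_iff n0 inner_axis' )
    then show "w = 0" using inj linear_inj_iff_eq_0[OF has_derivative_linear[OF D]] by (simp add: D_def)
  qed
  then have "inj (frechet_derivative \<nu> (at 0))" by (simp add: frechet_derivative_at[OF D\<nu>, symmetric])
  from smooth_inverse_function_theorem[OF U0(1) 0(1) \<nu> this]
  obtain S T \<phi> where ST: "open S" "0 \<in> S" "S \<subseteq> U0" "open T" "homeomorphism S T \<nu> \<phi>" "smooth_on T \<phi>" .
  show ?thesis
  proof (rule that[OF ST(1,2) _ ST(4) _ ST(5) smooth_on_subset[OF \<nu> ST(3)] ST(6)])
    show "S \<subseteq> U" using ST(3) U0(2) by simp
    show "0 \<in> T" "\<phi> 0 = 0"
      using homeomorphism_image1[OF ST(5)] homeomorphism_apply1[OF ST(5,2)] ST(2) 0(2) by force+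
    fix p assume p: "p \<in> T"
    have "\<phi> p \<in> U0" using homeomorphism_image2[OF ST(5)] p ST(3) by auto
    then show pos: "n (\<phi> p) $ 3 > 0" by (simp add: U0_def)
    have "p = (- inverse (n (\<phi> p) $ 3)) *\<^sub>R planar (n (\<phi> p))"
      using homeomorphism_apply2[OF ST(5) p] by (simp add: \<nu>_def)
    then have "n (\<phi> p) $ 3 *\<^sub>R p = n (\<phi> p) $ 3 *\<^sub>R ((- inverse (n (\<phi> p) $ 3)) *\<^sub>R planar (n (\<phi> p)))"
      by simp
    then show "planar (n (\<phi> p)) = - (n (\<phi> p) $ 3 *\<^sub>R p)" using pos by simp
  qed
qed

section \<open>The Legendre potential of a surface in slope coordinates\<close>

definition legendre_potential :: "(real^2 \<Rightarrow> real^3) \<Rightarrow> real^2 \<Rightarrow> real" where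
  "legendre_potential X p = p \<bullet> planar (X p) - X p $ 3"

text \<open>Orthogonality of the surface \<open>X\<close> to the field \<open>(-u, -v, 1)\<close>, as the vanishing of the contact form
  \<open>dX\<^sub>3 - u dX\<^sub>1 - v dX\<^sub>2\<close>.\<close>

definition contact_on :: "(real^2) set \<Rightarrow> (real^2 \<Rightarrow> real^3) \<Rightarrow> bool" where
  "contact_on T X \<longleftrightarrow> smooth_on T X \<and>
     (\<forall>p\<in>T. \<forall>w. frechet_derivative X (at p) w $ 3 = p \<bullet> planar (frechet_derivative X (at p) w))"

text \<open>By the contact condition the terms of the product rule that contain derivatives of \<open>X\<close> cancel.\<close>

lemma legendre_potential_has_derivative:
  assumes "contact_on T X" "p \<in> T"
  shows "(legendre_potential X has_derivative (\<lambda>w. w \<bullet> planar (X p))) (at p)"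
proof -
  have D: "(X has_derivative frechet_derivative X (at p)) (at p)"
    using assms smooth_on_has_derivative unfolding contact_on_def by blast
  have "((\<lambda>q. q \<bullet> planar (X q) - X q $ 3) has_derivative
     (\<lambda>w. (p \<bullet> planar (frechet_derivative X (at p) w) + w \<bullet> planar (X p)) - frechet_derivative X (at p) w $ 3)) (at p)"
    by (intro has_derivative_diff has_derivative_inner has_derivative_ident
        bounded_linear.has_derivative[OF bounded_linear_planar] bounded_linear.has_derivative[OF bounded_linear_vec_nth] D)
  then show ?thesis using assms by (simp add: legendre_potential_def[abs_def] contact_on_def)
qed

lemma legendre_potential_smooth:
  assumes "open T" "contact_on T X"
  shows "smooth_on T (legendre_potential X)"
proof -
  have X: "smooth_on T X" using assms(2) by (simp add: contact_on_def)
  have "Ck_on m T (\<lambda>p. w \<bullet> planar (X p))" for m w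
    using X unfolding smooth_on_def
    by (intro Ck_on_linear_compose[OF assms(1) bounded_linear_inner_right]
        Ck_on_linear_compose[OF assms(1) bounded_linear_planar]) blast
  then have "Ck_on (Suc m) T (legendre_potential X)" for m
    by (intro Ck_on_SucI[OF assms(1) legendre_potential_has_derivative[OF assms(2)]])
  then show ?thesis unfolding smooth_on_def using Ck_on_less by blast
qed

lemma partial_legendre_potential:
  assumes "contact_on T X" "p \<in> T"
  shows "partial 1 (legendre_potential X) p = X p $ 1" "partial 2 (legendre_potential X) p = X p $ 2"
  by (simp_all add: partial_def frechet_derivative_at[OF legendre_potential_has_derivative[OF assms], symmetric] inner_axis')

lemma partial_partial_legendre_potential:
  assumes "open T" "contact_on T X" "p \<in> T"
  shows "partial j (partial 1 (legendre_potential X)) p = partial j X p $ 1"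
    and "partial j (partial 2 (legendre_potential X)) p = partial j X p $ 2"
proof -
  have D: "((\<lambda>q. X q $ i) has_derivative (\<lambda>w. frechet_derivative X (at p) w $ i)) (at p)" for i
    using assms smooth_on_has_derivative unfolding contact_on_def
    by (intro bounded_linear.has_derivative[OF bounded_linear_vec_nth]) blast
  have "(partial 1 (legendre_potential X) has_derivative (\<lambda>w. frechet_derivative X (at p) w $ 1)) (at p)"
       "(partial 2 (legendre_potential X) has_derivative (\<lambda>w. frechet_derivative X (at p) w $ 2)) (at p)"
    by (rule has_derivative_transform_within_open[OF D assms(1,3)], simp add: partial_legendre_potential[OF assms(2)])+
  from this[THEN frechet_derivative_at, symmetric]
  show "partial j (partial 1 (legendre_potential X)) p = partial j X p $ 1"
    and "partial j (partial 2 (legendre_potential X)) p = partial j X p $ 2"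
    by (simp_all add: partial_def)
qed

lemma gradient_has_derivative:
  assumes "contact_on T X" "p \<in> T"
  shows "((\<lambda>q. a \<bullet> planar (X q)) has_derivative (\<lambda>b. a \<bullet> planar (frechet_derivative X (at p) b))) (at p)"
  using assms smooth_on_has_derivative unfolding contact_on_def
  by (intro bounded_linear.has_derivative[OF bounded_linear_inner_right]
      bounded_linear.has_derivative[OF bounded_linear_planar]) blast

text \<open>The planar part of \<open>X\<close> is the gradient of the potential, so its derivative is a Hessian.\<close>

lemma hessian_symmetric:
  assumes "open T" "contact_on T X" "p \<in> T"
  shows "planar (frechet_derivative X (at p) a) \<bullet> b = a \<bullet> planar (frechet_derivative X (at p) b)"
proof -
  have grad: "((\<lambda>q. frechet_derivative (legendre_potential X) (at q) a) has_derivative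
      (\<lambda>b. a \<bullet> planar (frechet_derivative X (at p) b))) (at p)" for a
    by (rule has_derivative_transform_within_open[OF gradient_has_derivative[OF assms(2,3)] assms(1,3)])
      (simp add: frechet_derivative_at[OF legendre_potential_has_derivative[OF assms(2)], symmetric])
  have "Ck_on (Suc (Suc 0)) T (legendre_potential X)"
    using legendre_potential_smooth[OF assms(1,2)] unfolding smooth_on_def by blast
  from mixed_second_derivatives_commute[OF assms(1,3) this, of a b]
  show ?thesis by (simp add: frechet_derivative_at[OF grad, symmetric] inner_commute)
qed

text \<open>The integrands of the normal form are the derivatives of \<open>X\<^sub>3\<close> given by the contact condition,
  along the path from the origin to \<open>(0, v)\<close> and on to \<open>(u, v)\<close>.\<close>

lemma normal_form_legendre_potential:
  assumes T: "open T" "ball 0 r \<subseteq> T" and X: "contact_on T X" and X0: "X 0 $ 3 = 0" and p: "p \<in> ball 0 r"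
  shows "normal_form (legendre_potential X) p = X p"
proof -
  let ?h = "legendre_potential X"
  define u v where "u = p $ 1" and "v = p $ 2"
  have FTC: "(LBINT t=ereal 0..ereal b. f t) = X (q + b *\<^sub>R axis i 1) $ 3 - X q $ 3"
    if line: "\<And>t. min 0 b \<le> t \<Longrightarrow> t \<le> max 0 b \<Longrightarrow> q + t *\<^sub>R axis i 1 \<in> T"
      and f: "\<And>t. min 0 b \<le> t \<Longrightarrow> t \<le> max 0 b \<Longrightarrow> f t = partial i X (q + t *\<^sub>R axis i 1) $ 3" for f b q i
  proof -
    have sm: "smooth_on T X" using X by (simp add: contact_on_def)
    have "continuous_on T (\<lambda>p. partial i X p $ 3)"
      unfolding partial_def by (intro continuous_intros smooth_on_continuous smooth_on_derivative sm)
    then have "continuous_on {min 0 b..max 0 b} (\<lambda>t. partial i X (q + t *\<^sub>R axis i 1) $ 3)"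
      by (rule continuous_on_compose2) (use line in \<open>auto intro!: continuous_intros\<close>)
    then have "continuous_on {min 0 b..max 0 b} f" by (rule continuous_on_eq) (use f in auto)
    moreover have "((\<lambda>t. X (q + t *\<^sub>R axis i 1) $ 3) has_vector_derivative f t) (at t within {min 0 b..max 0 b})"
      if t: "min 0 b \<le> t" "t \<le> max 0 b" for t
    proof -
      have "((\<lambda>p. X p $ 3) has_derivative (\<lambda>w. frechet_derivative X (at (q + t *\<^sub>R axis i 1)) w $ 3)) (at (q + t *\<^sub>R axis i 1))"
        by (intro bounded_linear.has_derivative[OF bounded_linear_vec_nth] smooth_on_has_derivative[OF sm] line t)
      from has_real_derivative_along_line[OF this]
      show ?thesis using f[OF t]
        by (simp add: partial_def has_real_derivative_iff_has_vector_derivative has_vector_derivative_at_within)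
    qed
    ultimately show ?thesis using interval_integral_FTC_finite[of 0 b f "\<lambda>t. X (q + t *\<^sub>R axis i 1) $ 3"] by simp
  qed
  have third: "q $ 1 * partial i (partial 1 ?h) q + q $ 2 * partial i (partial 2 ?h) q = partial i X q $ 3"
    if "q \<in> T" for q i
    using X that by (simp add: partial_partial_legendre_potential[OF T(1) X that])
      (simp add: contact_on_def partial_def inner_vec_def sum_2)
  have vec1: "(vector [t, v] :: real^2) = vector [0, v] + t *\<^sub>R axis 1 (1::real)" for t :: real
    by (simp add: vec_eq_iff forall_2 axis_def)
  have vec2: "(vector [0, t] :: real^2) = 0 + t *\<^sub>R axis 2 (1::real)" for t :: real
    by (simp add: vec_eq_iff forall_2 axis_def)
  have inT: "vector [a, b] \<in> T" if "\<bar>a\<bar> \<le> \<bar>u\<bar>" "\<bar>b\<bar> \<le> \<bar>v\<bar>" for a b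
  proof -
    have "norm (vector [a, b] :: real^2) \<le> norm p"
    proof (rule norm_le_componentwise_cart)
      show "norm (vector [a, b] $ i :: real) \<le> norm (p $ i)" for i
        using exhaust_2[of i] that by (auto simp: u_def v_def)
    qed
    then show ?thesis using p T(2) by (auto simp: dist_norm)
  qed
  have "(LBINT t=ereal 0..ereal u. t * partial 1 (partial 1 ?h) (vector [t, v]) + v * partial 1 (partial 2 ?h) (vector [t, v]))
      = X (vector [0, v] + u *\<^sub>R axis 1 1) $ 3 - X (vector [0, v]) $ 3"
  proof (rule FTC)
    fix t assume t: "min 0 u \<le> t" "t \<le> max 0 u"
    then have "vector [t, v] \<in> T" by (intro inT) auto
    from this third[OF this, of 1]
    show "vector [0, v] + t *\<^sub>R axis 1 1 \<in> T"
      "t * partial 1 (partial 1 ?h) (vector [t, v]) + v * partial 1 (partial 2 ?h) (vector [t, v]) =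
       partial 1 X (vector [0, v] + t *\<^sub>R axis 1 1) $ 3"
      by (simp_all add: vec1[symmetric])
  qed
  moreover have "(LBINT t=ereal 0..ereal v. t * partial 2 (partial 2 ?h) (vector [0, t]))
      = X (0 + v *\<^sub>R axis 2 1) $ 3 - X 0 $ 3"
  proof (rule FTC)
    fix t assume t: "min 0 v \<le> t" "t \<le> max 0 v"
    then have "vector [0, t] \<in> T" by (intro inT) auto
    from this third[OF this, of 2]
    show "0 + t *\<^sub>R axis 2 1 \<in> T"
      "t * partial 2 (partial 2 ?h) (vector [0, t]) = partial 2 X (0 + t *\<^sub>R axis 2 1) $ 3"
      unfolding vec2[symmetric] by simp_all
  qed
  moreover have "vector [u, v] = p" by (simp add: vec_eq_iff forall_2 u_def v_def)
  moreover have "v *\<^sub>R axis 2 1 = (vector [0, v] :: real^2)" using vec2[of v] by simp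
  moreover have "p \<in> T" using p T(2) by auto
  ultimately show ?thesis
    by (simp add: normal_form_def Let_def u_def[symmetric] v_def[symmetric] vec1[symmetric]
        X0 vec_eq_iff forall_3 partial_legendre_potential[OF X])
qed

lemma convex_or_concave_legendre_potential:
  assumes W: "open W" "convex W" and X: "contact_on W X" and \<sigma>: "\<sigma> = 1 \<or> \<sigma> = (-1::real)"
    and semi: "\<And>p w. p \<in> W \<Longrightarrow> \<sigma> * (w \<bullet> planar (frechet_derivative X (at p) w)) \<le> 0"
  shows "concave_on W (legendre_potential X) \<or> convex_on W (legendre_potential X)"
proof -
  have "convex_on W (\<lambda>p. (- \<sigma>) * legendre_potential X p)"
  proof (rule convex_on_second_derivative_nonneg[OF W(2)])
    show "((\<lambda>p. (- \<sigma>) * legendre_potential X p) has_derivative (\<lambda>w. (- \<sigma>) * (w \<bullet> planar (X p)))) (at p)" if "p \<in> W" for p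
      by (intro has_derivative_mult_right legendre_potential_has_derivative[OF X that])
    show "((\<lambda>q. (- \<sigma>) * (w \<bullet> planar (X q))) has_derivative
        (\<lambda>b. (- \<sigma>) * (w \<bullet> planar (frechet_derivative X (at p) b)))) (at p)" if "p \<in> W" for p w
      by (intro has_derivative_mult_right gradient_has_derivative[OF X that])
    show "0 \<le> (- \<sigma>) * (w \<bullet> planar (frechet_derivative X (at p) w))" if "p \<in> W" for p w
      using semi[OF that] by simp
  qed
  then show ?thesis using \<sigma> by (auto simp: concave_on_def)
qed

section \<open>Semidefiniteness from immersed parallel surfaces\<close>

text \<open>The sign \<open>\<sigma>\<close> tells on which side the parallel surfaces are immersed.  Multiplying the derivative
  of \<open>x - l n\<close> by \<open>-1\<close> gives both cases the same form with \<open>l > 0\<close>.\<close>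

lemma parallelly_smoothable_imp_injective:
  assumes ps: "parallelly_smoothable_at U x n p" and x: "smooth_on U x" and n: "smooth_on U n"
  obtains \<epsilon> V \<sigma> where "\<epsilon> > 0" "open V" "p \<in> V" "V \<subseteq> U" "\<sigma> = 1 \<or> \<sigma> = (-1::real)"
    "\<And>q l. q \<in> V \<Longrightarrow> 0 < l \<Longrightarrow> l < \<epsilon> \<Longrightarrow>
       inj (\<lambda>w. \<sigma> *\<^sub>R frechet_derivative x (at q) w + l *\<^sub>R frechet_derivative n (at q) w)"
proof -
  obtain \<epsilon> V where \<epsilon>: "\<epsilon> > 0" and V: "open V" "p \<in> V" "V \<subseteq> U" and rk:
    "(\<forall>q\<in>V. \<forall>l\<in>{0<..<\<epsilon>}. rank (jacobian (\<lambda>r. x r + l *\<^sub>R n r) (at q)) = 2) \<or>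
     (\<forall>q\<in>V. \<forall>l\<in>{-\<epsilon><..<0}. rank (jacobian (\<lambda>r. x r + l *\<^sub>R n r) (at q)) = 2)"
    using ps unfolding parallelly_smoothable_at_def by blast
  have iff: "rank (jacobian (\<lambda>r. x r + l *\<^sub>R n r) (at q)) = 2 \<longleftrightarrow>
      inj (\<lambda>w. frechet_derivative x (at q) w + l *\<^sub>R frechet_derivative n (at q) w)" if "q \<in> V" for q l
  proof -
    have "q \<in> U" using that V by auto
    note D = smooth_on_has_derivative[OF x this] smooth_on_has_derivative[OF n this]
    show ?thesis
      using rank_jacobian_full_iff_inj[OF has_derivative_add[OF D(1) has_derivative_scaleR_right[OF D(2), of l]]] by simp
  qed
  from rk show ?thesis
  proof
    assume "\<forall>q\<in>V. \<forall>l\<in>{0<..<\<epsilon>}. rank (jacobian (\<lambda>r. x r + l *\<^sub>R n r) (at q)) = 2"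
    then show ?thesis using iff by (intro that[OF \<epsilon> V, of 1]) auto
  next
    assume neg: "\<forall>q\<in>V. \<forall>l\<in>{-\<epsilon><..<0}. rank (jacobian (\<lambda>r. x r + l *\<^sub>R n r) (at q)) = 2"
    show ?thesis
    proof (rule that[OF \<epsilon> V, of "-1"])
      fix q l assume q: "q \<in> V" and l: "0 < l" "l < \<epsilon>"
      have "- l \<in> {-\<epsilon><..<0}" using l by simp
      with neg q have "rank (jacobian (\<lambda>r. x r + (- l) *\<^sub>R n r) (at q)) = 2" by blast
      then have "inj (\<lambda>w. frechet_derivative x (at q) w + (- l) *\<^sub>R frechet_derivative n (at q) w)"
        by (simp only: iff[OF q])
      from inj_compose[OF inj_uminus this]
      show "inj (\<lambda>w. (- 1) *\<^sub>R frechet_derivative x (at q) w + l *\<^sub>R frechet_derivative n (at q) w)"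
        by (simp add: o_def)
    qed simp
  qed
qed

text \<open>Here \<open>X'\<close> and \<open>N'\<close> are the derivatives at \<open>p\<close> of a surface (up to a sign) and of its unit normal
  \<open>m (-p, 1)\<close>.  The planar part of \<open>-N'\<close> turns out to be symmetric and positive definite, with a bound
  that is uniform for \<open>p\<close> in the unit disc.  A positive value of the form of \<open>X'\<close> would therefore give a
  generalized eigenvalue \<open>l < \<epsilon>\<close>; as third components are determined by planar parts, its
  eigenvector would be in the kernel of \<open>X' + l N'\<close>.\<close>

lemma semidefinite_of_parallel_injective:
  fixes p :: "real^2" and X' N' :: "real^2 \<Rightarrow> real^3"
  assumes lin: "linear X'" "linear N'"
    and contact: "\<And>w. X' w $ 3 = p \<bullet> planar (X' w)" "\<And>w. N' w $ 3 = p \<bullet> planar (N' w)"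
    and N': "\<And>w. planar (N' w) = - (m *\<^sub>R w) - (N' w $ 3) *\<^sub>R p"
    and m: "m > 0" "m\<^sup>2 * (1 + p \<bullet> p) = 1" and p: "norm p \<le> 1"
    and sym: "\<And>z w. planar (X' z) \<bullet> w = z \<bullet> planar (X' w)"
    and small: "\<And>w. planar (X' w) \<bullet> w \<le> \<epsilon> / 8 * (w \<bullet> w)"
    and inj: "\<And>l. 0 < l \<Longrightarrow> l < \<epsilon> \<Longrightarrow> inj (\<lambda>w. X' w + l *\<^sub>R N' w)"
  shows "planar (X' w) \<bullet> w \<le> 0"
proof (rule ccontr)
  assume "\<not> ?thesis"
  then have w: "planar (X' w) \<bullet> w > 0" by simp
  define S where "S w = - planar (N' w)" for w
  have pp: "0 \<le> p \<bullet> p" "p \<bullet> p \<le> 1" using p by (auto simp: dot_square_norm power_le_one)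
  \<comment> \<open>The contact condition for \<open>N'\<close> is a linear equation for the third component; solving it gives
    the Hessian of \<open>\<surd>(1 + u\<^sup>2 + v\<^sup>2)\<close>.\<close>
  have S: "S w = m *\<^sub>R w - (m^3 * (p \<bullet> w)) *\<^sub>R p" for w
  proof -
    have "N' w $ 3 = - (m * (p \<bullet> w)) - N' w $ 3 * (p \<bullet> p)"
      using contact(2)[of w] unfolding N' by (simp add: inner_diff_right)
    then have "N' w $ 3 * (1 + p \<bullet> p) = - (m * (p \<bullet> w))" by (simp add: algebra_simps)
    then have "N' w $ 3 * (m\<^sup>2 * (1 + p \<bullet> p)) = - (m^3 * (p \<bullet> w))"
      by (simp add: power2_eq_square power3_eq_cube mult.assoc mult.left_commute)
    then have "N' w $ 3 = - (m^3 * (p \<bullet> w))" by (simp add: m(2))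
    then show ?thesis by (simp add: S_def N')
  qed
  \<comment> \<open>The smaller eigenvalue of \<open>S\<close> is \<open>m\<^sup>3\<close>, and \<open>m \<ge> 1 / \<surd>2\<close> on the unit disc.\<close>
  have coercive: "S w \<bullet> w \<ge> (w \<bullet> w) / 4" for w
  proof -
    have "(p \<bullet> w)\<^sup>2 \<le> (p \<bullet> p) * (w \<bullet> w)" by (rule Cauchy_Schwarz_ineq)
    then have "m^3 * (p \<bullet> w)\<^sup>2 \<le> m^3 * ((p \<bullet> p) * (w \<bullet> w))" using m(1) by (intro mult_left_mono) auto
    then have "S w \<bullet> w \<ge> m * (1 - m\<^sup>2 * (p \<bullet> p)) * (w \<bullet> w)"
      by (simp add: S inner_diff_left power2_eq_square power3_eq_cube algebra_simps)
    moreover have "1 - m\<^sup>2 * (p \<bullet> p) = m\<^sup>2" using m(2) by (simp add: algebra_simps)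
    ultimately have "S w \<bullet> w \<ge> m * m\<^sup>2 * (w \<bullet> w)" by simp
    moreover have "m\<^sup>2 * (1 + p \<bullet> p) \<le> m\<^sup>2 * 2" using pp by (intro mult_left_mono) auto
    then have m2: "m\<^sup>2 \<ge> 1 / 2" using m(2) by simp
    then have "m \<ge> 1 / 2" using power2_le_imp_le[of "1/2" m] m(1) by (simp add: power2_eq_square)
    then have "1 / 2 * (1 / 2) \<le> m * m\<^sup>2" using m2 by (intro mult_mono) auto
    then have "(w \<bullet> w) / 4 \<le> m * m\<^sup>2 * (w \<bullet> w)" using mult_right_mono[of "1/4" "m * m\<^sup>2" "w \<bullet> w"] by simp
    ultimately show ?thesis by simp
  qed
  have lin_planar: "linear (\<lambda>w. planar (L w))" if "linear L" for L :: "real^2 \<Rightarrow> real^3"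
    using linear_compose[OF that bounded_linear.linear[OF bounded_linear_planar]] by (simp add: o_def)
  obtain l z where l: "l > 0" "z \<noteq> 0" "planar (X' z) = l *\<^sub>R S z"
  proof (rule generalized_eigenvector[where H="\<lambda>w. planar (X' w)" and S=S and z=w])
    show "linear S" unfolding S_def by (intro linear_compose_neg lin_planar lin)
    show "S y \<bullet> z = y \<bullet> S z" for y z
      by (simp add: S inner_diff_left inner_diff_right inner_commute)
    show "S y \<bullet> y > 0" if "y \<noteq> 0" for y
      using coercive[of y] that inner_gt_zero_iff[of y] by linarith
  qed (use lin lin_planar sym w in auto)
  \<comment> \<open>The bounds \<open>1 / 4\<close> for \<open>S\<close> and \<open>\<epsilon> / 8\<close> for the form of \<open>X'\<close> leave \<open>l \<le> \<epsilon> / 2\<close>.\<close>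
  have zz: "z \<bullet> z > 0" using l by simp
  have "l * ((z \<bullet> z) / 4) \<le> l * (S z \<bullet> z)" using l(1) coercive[of z] by (intro mult_left_mono) auto
  also have "\<dots> \<le> \<epsilon> / 8 * (z \<bullet> z)" using small[of z] l(3) by simp
  finally have "2 * l \<le> \<epsilon>" using zz by (simp add: field_simps)
  then have "inj (\<lambda>w. X' w + l *\<^sub>R N' w)" using inj l(1) by simp
  moreover have "linear (\<lambda>w. X' w + l *\<^sub>R N' w)"
    by (intro linear_compose_add linear_compose_scale_right lin)
  moreover have "X' z + l *\<^sub>R N' z = 0"
  proof -
    have "planar (X' z + l *\<^sub>R N' z) = 0" using l(3) by (simp add: S_def)
    moreover have "(X' z + l *\<^sub>R N' z) $ 3 = p \<bullet> planar (X' z + l *\<^sub>R N' z)"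
      by (simp add: contact inner_add_right)
    ultimately show ?thesis by (simp add: vec3_eq_0_iff)
  qed
  ultimately show False using l(2) linear_inj_iff_eq_0 by blast
qed

lemma derivative_small_near_critical_point:
  fixes X :: "real^2 \<Rightarrow> 'b::real_normed_vector"
  assumes T: "open T" "p \<in> T" and X: "smooth_on T X" and crit: "\<And>w. frechet_derivative X (at p) w = 0" and \<eta>: "\<eta> > 0"
  obtains r where "r > 0" "ball p r \<subseteq> T" "\<And>q w. q \<in> ball p r \<Longrightarrow> norm (frechet_derivative X (at q) w) \<le> \<eta> * norm w"
proof -
  have "\<forall>\<^sub>F q in nhds p. dist (partial i X q) 0 < \<eta> / 2" for i
  proof -
    have "continuous (at p) (partial i X)"
      using smooth_on_continuous[OF smooth_on_derivative[OF X, of "axis i 1"]] T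
      by (simp add: partial_def[abs_def] continuous_on_eq_continuous_at)
    then have "(partial i X \<longlongrightarrow> partial i X p) (nhds p)"
      by (simp add: continuous_at tendsto_at_iff_tendsto_nhds)
    moreover have "partial i X p = 0" by (simp add: partial_def crit)
    ultimately show ?thesis using tendstoD[of "partial i X" 0 "nhds p" "\<eta> / 2"] \<eta> by simp
  qed
  then have "\<forall>\<^sub>F q in nhds p. q \<in> T \<and> dist (partial 1 X q) 0 < \<eta> / 2 \<and> dist (partial 2 X q) 0 < \<eta> / 2"
    using T by (intro eventually_conj eventually_nhds_in_open)
  then obtain r where r: "r > 0" and small: "\<And>q. dist q p < r \<Longrightarrow>
      q \<in> T \<and> dist (partial 1 X q) 0 < \<eta> / 2 \<and> dist (partial 2 X q) 0 < \<eta> / 2"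
    by (auto simp: eventually_nhds_metric)
  show ?thesis
  proof (rule that[OF r])
    show "ball p r \<subseteq> T" using small by (auto simp: dist_commute)
    fix q w assume "q \<in> ball p r"
    then have q: "q \<in> T" and bd: "norm (partial 1 X q) \<le> \<eta> / 2" "norm (partial 2 X q) \<le> \<eta> / 2"
      using small[of q] by (auto simp: dist_commute)
    have "norm (frechet_derivative X (at q) w) = norm (w $ 1 *\<^sub>R partial 1 X q + w $ 2 *\<^sub>R partial 2 X q)"
      using linear_axis_expansion[OF has_derivative_linear[OF smooth_on_has_derivative[OF X q]], of w]
      by (simp add: partial_def)
    also have "\<dots> \<le> \<bar>w $ 1\<bar> * norm (partial 1 X q) + \<bar>w $ 2\<bar> * norm (partial 2 X q)"
      by (rule order.trans[OF norm_triangle_ineq]) simp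
    also have "\<dots> \<le> norm w * (\<eta> / 2) + norm w * (\<eta> / 2)"
      using bd component_le_norm_cart[of w] by (intro add_mono mult_mono) auto
    finally show "norm (frechet_derivative X (at q) w) \<le> \<eta> * norm w" by (simp add: mult.commute)
  qed
qed

section \<open>The normal form\<close>

theorem corollary4p5:
  fixes U :: "(real^2) set" and x n :: "real^2 \<Rightarrow> real^3"
  assumes "open U" and "0 \<in> U" and "x 0 = 0"
    and "wavefront U x"
    and "unit_normal_on U x n"
    and "0 \<in> singular_set U x"
    and "parallelly_smoothable_at U x n 0"
    and "rank (jacobian x (at 0)) = 0"
  shows "\<exists>A W h. euclidean_isometry A \<and>
           open W \<and> convex W \<and> 0 \<in> W \<and>
           smooth_on W h \<and> (concave_on W h \<or> convex_on W h) \<and>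
           partial 1 (partial 1 h) 0 = 0 \<and>
           partial 2 (partial 1 h) 0 = 0 \<and>
           partial 2 (partial 2 h) 0 = 0 \<and>
           R_equivalent_at 0 (A \<circ> x) (normal_form h)"
proof -
  note U = \<open>open U\<close> \<open>0 \<in> U\<close>
  have x: "smooth_on U x" using assms(4) by (simp add: wavefront_def frontal_def)
  have n: "smooth_on U n" and unit: "\<And>q. q \<in> U \<Longrightarrow> norm (n q) = 1"
    using assms(5) by (auto simp: unit_normal_on_def)
  have crit: "frechet_derivative x (at 0) w = 0" for w
  proof -
    have "jacobian x (at 0) = 0" using assms(8) by (simp add: rank_eq_0)
    moreover have "(x has_derivative (\<lambda>h. jacobian x (at 0) *v h)) (at 0)"
      using smooth_on_has_derivative[OF x U(2)] jacobian_works[of x "at 0"] differentiable_def by blast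
    ultimately show ?thesis using frechet_derivative_at[of x _ 0] by (metis matrix_vector_mult_0)
  qed
  obtain \<epsilon> V \<sigma> where \<epsilon>: "\<epsilon> > 0" and V: "open V" "0 \<in> V" "V \<subseteq> U" and \<sigma>: "\<sigma> = 1 \<or> \<sigma> = (-1::real)"
    and inj: "\<And>q l. q \<in> V \<Longrightarrow> 0 < l \<Longrightarrow> l < \<epsilon> \<Longrightarrow>
       inj (\<lambda>w. \<sigma> *\<^sub>R frechet_derivative x (at q) w + l *\<^sub>R frechet_derivative n (at q) w)"
    using parallelly_smoothable_imp_injective[OF assms(7) x n] by blast
  have inj_n: "inj (frechet_derivative n (at 0))"
  proof (rule injI)
    fix v w assume "frechet_derivative n (at 0) v = frechet_derivative n (at 0) w"
    then show "v = w" using injD[OF inj[OF V(2), of "\<epsilon> / 2"], of v w] \<epsilon> by (simp add: crit)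
  qed
  obtain A :: "real^3 \<Rightarrow> real^3" where A: "orthogonal_transformation A" and An0: "A (n 0) = axis 3 1"
    by (rule orthogonal_transformation_exists_1[OF unit[OF U(2)] norm_axis_1])
  have linA: "linear A" and normA: "\<And>y. norm (A y) = norm y" and innerA: "\<And>y z. A y \<bullet> A z = y \<bullet> z"
    using A orthogonal_transformation_norm[OF A] unfolding orthogonal_transformation_def by blast+
  have blA: "bounded_linear A" using linA linear_conv_bounded_linear by blast
  have injA: "A y = 0 \<longleftrightarrow> y = 0" for y using normA[of y] by auto
  define DA where "DA f q w = A (frechet_derivative f (at q) w)" for f :: "real^2 \<Rightarrow> real^3" and q w
  have DA: "((\<lambda>q. A (f q)) has_derivative DA f q) (at q)" if "smooth_on U f" "q \<in> U" for f q
    unfolding DA_def by (rule bounded_linear.has_derivative[OF blA smooth_on_has_derivative[OF that]])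
  have An: "smooth_on V (\<lambda>q. A (n q))"
    by (rule smooth_on_linear_compose[OF V(1) blA smooth_on_subset[OF n V(3)]])
  have inj_An: "inj (frechet_derivative (\<lambda>q. A (n q)) (at 0))"
  proof -
    have "inj (DA n 0)"
      using linear_inj_iff_eq_0[OF has_derivative_linear[OF DA[OF n U(2)]]]
        linear_inj_iff_eq_0[OF has_derivative_linear[OF smooth_on_has_derivative[OF n U(2)]]] inj_n
      by (simp add: DA_def injA)
    then show ?thesis by (simp add: frechet_derivative_at[OF DA[OF n U(2)], symmetric])
  qed
  have unitA: "norm (A (n q)) = 1" if "q \<in> V" for q using unit V(3) that by (auto simp: normA)
  obtain S T \<nu> \<phi> where S: "open S" "0 \<in> S" "S \<subseteq> V" and T: "open T" "0 \<in> T" and hom: "homeomorphism S T \<nu> \<phi>"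
    and \<nu>: "smooth_on S \<nu>" and \<phi>: "smooth_on T \<phi>" "\<phi> 0 = 0"
    and slope: "\<And>p. p \<in> T \<Longrightarrow> A (n (\<phi> p)) $ 3 > 0"
      "\<And>p. p \<in> T \<Longrightarrow> planar (A (n (\<phi> p))) = - (A (n (\<phi> p)) $ 3 *\<^sub>R p)"
    using slope_coordinates[OF V(1,2) An unitA An0 inj_An] by blast
  have \<phi>S: "\<phi> p \<in> S" if "p \<in> T" for p using homeomorphism_image2[OF hom] that by auto
  have \<phi>U: "\<phi> p \<in> U" if "p \<in> T" for p using \<phi>S[OF that] S(3) V(3) by auto
  \<comment> \<open>The rotated surface and its normal in slope coordinates.\<close>
  define X where "X p = A (x (\<phi> p))" for p
  define N where "N p = A (n (\<phi> p))" for p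
  define m where "m p = N p $ 3" for p
  define D\<phi> where "D\<phi> p = frechet_derivative \<phi> (at p)" for p
  have D\<phi>: "(\<phi> has_derivative D\<phi> p) (at p)" if "p \<in> T" for p
    unfolding D\<phi>_def by (rule smooth_on_has_derivative[OF \<phi>(1) that])
  have inj\<phi>: "inj (D\<phi> p)" if "p \<in> T" for p
    using inj_derivative_of_invertible[OF D\<phi>[OF that] smooth_on_has_derivative[OF \<nu> \<phi>S[OF that]] T(1) that]
      homeomorphism_apply2[OF hom] by blast
  have chain: "((\<lambda>p. A (f (\<phi> p))) has_derivative (\<lambda>w. DA f (\<phi> p) (D\<phi> p w))) (at p)"
    if "smooth_on U f" "p \<in> T" for f p
    by (rule has_derivative_compose[OF D\<phi>[OF that(2)] DA[OF that(1) \<phi>U[OF that(2)]]])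
  have smooth: "smooth_on T (\<lambda>p. A (f (\<phi> p)))" if "smooth_on U f" for f :: "real^2 \<Rightarrow> real^3"
    by (rule smooth_on_compose[OF T(1) U(1) _ smooth_on_linear_compose[OF U(1) blA that] \<phi>(1)]) (use \<phi>U in auto)
  have X: "smooth_on T X" and N: "smooth_on T N"
    using smooth[OF x] smooth[OF n] by (simp_all add: X_def[abs_def] N_def[abs_def])
  have DX: "frechet_derivative X (at p) w = DA x (\<phi> p) (D\<phi> p w)"
    and DN: "frechet_derivative N (at p) w = DA n (\<phi> p) (D\<phi> p w)" if "p \<in> T" for p w
    by (simp_all add: X_def[abs_def] N_def[abs_def]
        frechet_derivative_at[OF chain[OF x that], symmetric] frechet_derivative_at[OF chain[OF n that], symmetric])
  have unitN: "norm (N p) = 1" if "p \<in> T" for p using unit[OF \<phi>U[OF that]] by (simp add: N_def normA)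
  have mN: "m p > 0" "planar (N p) = - (m p *\<^sub>R p)" if "p \<in> T" for p
    using slope[OF that] by (simp_all add: m_def N_def)
  have contact: "y $ 3 = p \<bullet> planar y" if p: "p \<in> T" and y: "N p \<bullet> y = 0" for p y
    using y mN[OF p] by (simp add: inner_eq_planar[of "N p"] m_def[symmetric])
  have contactX: "frechet_derivative X (at p) w $ 3 = p \<bullet> planar (frechet_derivative X (at p) w)" if "p \<in> T" for p w
  proof (rule contact[OF that])
    have "x differentiable (at (\<phi> p))" using smooth_on_has_derivative[OF x \<phi>U[OF that]] differentiable_def by blast
    from unit_normal_on_orthogonal[OF assms(5) \<phi>U[OF that] this]
    show "N p \<bullet> frechet_derivative X (at p) w = 0" by (simp add: DX[OF that] N_def DA_def innerA)
  qed
  then have cX: "contact_on T X" using X by (simp add: contact_on_def)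
  have contactN: "frechet_derivative N (at p) w $ 3 = p \<bullet> planar (frechet_derivative N (at p) w)" if "p \<in> T" for p w
    by (rule contact[OF that unit_field_orthogonal_derivative[OF T(1) that unitN smooth_on_has_derivative[OF N that]]])
  \<comment> \<open>The product rule for \<open>planar (N p) = - m(p) p\<close>.\<close>
  have planarN: "planar (frechet_derivative N (at p) w) = - (m p *\<^sub>R w) - (frechet_derivative N (at p) w $ 3) *\<^sub>R p"
    if "p \<in> T" for p w
  proof -
    note D = smooth_on_has_derivative[OF N that]
    have "((\<lambda>q. - (N q $ 3 *\<^sub>R q)) has_derivative
        (\<lambda>w. - (N p $ 3 *\<^sub>R w + frechet_derivative N (at p) w $ 3 *\<^sub>R p))) (at p)"
      by (intro has_derivative_minus has_derivative_scaleR bounded_linear.has_derivative[OF bounded_linear_vec_nth] D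
          has_derivative_ident)
    then have "((\<lambda>q. planar (N q)) has_derivative
        (\<lambda>w. - (N p $ 3 *\<^sub>R w + frechet_derivative N (at p) w $ 3 *\<^sub>R p))) (at p)"
      by (rule has_derivative_transform_within_open[OF _ T(1) that]) (simp add: mN m_def)
    from has_derivative_unique[OF bounded_linear.has_derivative[OF bounded_linear_planar D] this]
    show ?thesis by (simp add: m_def fun_eq_iff)
  qed
  have msq: "(m p)\<^sup>2 * (1 + p \<bullet> p) = 1" if "p \<in> T" for p
  proof -
    have "N p \<bullet> N p = 1" using unitN[OF that] by (simp add: dot_square_norm)
    then show ?thesis by (simp add: inner_eq_planar[of "N p"] mN[OF that] m_def[symmetric] power2_eq_square algebra_simps)
  qed
  have DX0: "frechet_derivative X (at 0) w = 0" for w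
    by (simp add: DX[OF T(2)] \<phi>(2) DA_def crit linear_0[OF linA])
  obtain r0 where r0: "r0 > 0" "ball 0 r0 \<subseteq> T"
    and small: "\<And>q w. q \<in> ball 0 r0 \<Longrightarrow> norm (frechet_derivative X (at q) w) \<le> \<epsilon> / 8 * norm w"
    using derivative_small_near_critical_point[OF T X DX0, of "\<epsilon> / 8"] \<epsilon> by auto
  \<comment> \<open>The radius is at most \<open>1\<close> because the lower bound for the form of \<open>S\<close> is uniform only over bounded slopes.\<close>
  define r where "r = min 1 r0"
  define W where "W = ball (0::real^2) r"
  have W: "open W" "convex W" "0 \<in> W" "W \<subseteq> T" using r0 by (auto simp: W_def r_def)
  have semi: "\<sigma> * (w \<bullet> planar (frechet_derivative X (at p) w)) \<le> 0" if p: "p \<in> W" for p w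
  proof -
    have pT: "p \<in> T" using p W(4) by auto
    let ?X' = "\<lambda>w. \<sigma> *\<^sub>R frechet_derivative X (at p) w" and ?N' = "frechet_derivative N (at p)"
    note linX = has_derivative_linear[OF smooth_on_has_derivative[OF X pT]]
    note linN = has_derivative_linear[OF smooth_on_has_derivative[OF N pT]]
    have "planar (?X' w) \<bullet> w \<le> 0"
    proof (rule semidefinite_of_parallel_injective[OF _ linN _ contactN[OF pT] planarN[OF pT] mN(1)[OF pT] msq[OF pT]])
      show "linear ?X'" by (rule linear_compose_scale_right[OF linX])
      show "?X' w $ 3 = p \<bullet> planar (?X' w)" for w by (simp add: contactX[OF pT])
      show "norm p \<le> 1" using p by (simp add: W_def r_def)
      show "planar (?X' z) \<bullet> w = z \<bullet> planar (?X' w)" for z w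
        using hessian_symmetric[OF T(1) cX pT] by simp
      show "planar (?X' w) \<bullet> w \<le> \<epsilon> / 8 * (w \<bullet> w)" for w
      proof -
        have "planar (?X' w) \<bullet> w \<le> norm (planar (?X' w)) * norm w" by (rule norm_cauchy_schwarz)
        also have "\<dots> \<le> (\<epsilon> / 8 * norm w) * norm w"
        proof (rule mult_right_mono)
          have "norm (planar (?X' w)) \<le> norm (?X' w)" by (rule norm_planar_le)
          also have "\<dots> = norm (frechet_derivative X (at p) w)" using \<sigma> by auto
          also have "\<dots> \<le> \<epsilon> / 8 * norm w" using small p by (simp add: W_def r_def)
          finally show "norm (planar (?X' w)) \<le> \<epsilon> / 8 * norm w" .
        qed simp
        finally show ?thesis by (simp add: dot_square_norm power2_eq_square)
      qed
      show "inj (\<lambda>w. ?X' w + l *\<^sub>R ?N' w)" if l: "0 < l" "l < \<epsilon>" for l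
      proof -
        have "(\<lambda>w. ?X' w + l *\<^sub>R ?N' w) =
          A \<circ> (\<lambda>w. \<sigma> *\<^sub>R frechet_derivative x (at (\<phi> p)) w + l *\<^sub>R frechet_derivative n (at (\<phi> p)) w) \<circ> D\<phi> p"
          by (auto simp: fun_eq_iff DX[OF pT] DN[OF pT] DA_def linear_add[OF linA] linear_scale[OF linA])
        moreover have "inj A" using linear_inj_iff_eq_0[OF linA] injA by blast
        ultimately show ?thesis using inj[of "\<phi> p" l] \<phi>S[OF pT] S(3) l inj\<phi>[OF pT]
          by (auto intro!: inj_compose)
      qed
    qed
    then show ?thesis by (simp add: inner_commute)
  qed
  define h where "h = legendre_potential X"
  have "contact_on W X" using cX smooth_on_subset[OF X W(4)] W(4) by (auto simp: contact_on_def)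
  then have shape: "concave_on W h \<or> convex_on W h"
    unfolding h_def using W(1,2) \<sigma> semi by (intro convex_or_concave_legendre_potential)
  have smooth_h: "smooth_on W h"
    using smooth_on_subset[OF legendre_potential_smooth[OF T(1) cX] W(4)] by (simp add: h_def)
  have hess0: "partial j (partial 1 h) 0 = 0" "partial j (partial 2 h) 0 = 0" for j
    by (simp_all add: h_def partial_partial_legendre_potential[OF T(1) cX T(2)]) (simp_all add: partial_def DX0)
  have "normal_form h p = A (x (\<phi> p))" if "p \<in> W" for p
  proof -
    have "X 0 $ 3 = 0" by (simp add: X_def \<phi>(2) assms(3) linear_0[OF linA])
    from normal_form_legendre_potential[OF T(1) W(4)[unfolded W_def] cX this] that
    have "normal_form h p = X p" by (simp add: h_def W_def)
    then show ?thesis by (simp add: X_def)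
  qed
  then have "\<forall>\<^sub>F w in nhds 0. normal_form h w = (A \<circ> x) (\<phi> w)"
    using W(1,3) unfolding eventually_nhds by auto
  moreover have "diffeo_germ \<phi> 0 0"
    unfolding diffeo_germ_def using \<phi> T S(1) \<nu> homeomorphism_symD[OF hom] by blast
  ultimately have "R_equivalent_at 0 (A \<circ> x) (normal_form h)"
    unfolding R_equivalent_at_def by blast
  moreover have "euclidean_isometry A"
    using orthogonal_transformation_bij[OF A] normA linear_diff[OF linA]
    by (simp add: euclidean_isometry_def dist_norm) (metis normA)
  ultimately show ?thesis using W shape smooth_h hess0 by blast
qed

end
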